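(* Let $L$ be an even lattice, $D=L'/L$, $k\in\frac12\mathbb Z$, $m\in\mathbb N$, and let $f\in S_{L,k}$ be a nonzero eigenform of the Hecke operator $T(m^2)$ with eigenvalue $\Lambda_m$. Let ${}_mD$ denote the $m$-torsion subgroup of $D$ and $\overline\Gamma=\mathrm{Mp}_2(\mathbb Z)$. Then $$|\Lambda_m|<m^{k-2}\,\big|\overline\Gamma\backslash\overline\Gamma g(m^2)\overline\Gamma\big|\cdot|{}_mD|.$$ In the particular case where $m=p$ is a prime, $$|\Lambda_p|<p^{k-1}\cdot(p+1)\cdot|{}_pD|.$$
   Context: **Lattices.** $(L,q)$ is a non-degenerate even lattice: a finitely generated free $\mathbb Z$-module with non-degenerate symmetric integral bilinear form $\beta$ and $q(x)=\beta(x,x)/2\in\mathbb Z$; signature $(b^+,b^-)$. $L'$ is the dual lattice; $D=L'/L$ with induced quadratic form $\bar q:D\to\mathbb Q/\mathbb Z$ and bilinear form $\beta$; $\mathrm{sig}(D)=b^+-b^-\bmod8$. $\mathbb C[D]$ is the group algebra with basis $\mathfrak e_\lambda$. $e(x)=e^{2\pi ix}$. **Weil representation and modular forms.** $\widetilde{\mathrm{GL}}_2^+(\mathbb R)$ consists of pairs $(\gamma,\phi)$ with $\gamma=\begin{pmatrix}a&b\\c&d\end{pmatrix}\in\mathrm{GL}_2^+(\mathbb R)$ and $\phi$ holomorphic on the upper half plane $\mathbb H$, $\phi(\tau)^2=c\tau+d$; product $(\gamma,\phi)(\gamma',\phi')=(\gamma\gamma',\phi(\gamma'\tau)\phi'(\tau))$.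 $\mathrm{Mp}_2(\mathbb Z)$ is the preimage of $\mathrm{SL}_2(\mathbb Z)$, generated by $\overline T=(\begin{pmatrix}1&1\\0&1\end{pmatrix},1)$, $\overline S=(\begin{pmatrix}0&-1\\1&0\end{pmatrix},\sqrt\tau)$. The Weil representation: $\rho_L(\overline T)\mathfrak e_\lambda=e(\bar q(\lambda))\mathfrak e_\lambda$, $\rho_L(\overline S)\mathfrak e_\lambda=\frac{e(-\mathrm{sig}(D)/8)}{\sqrt{|D|}}\sum_\mu e(-\beta(\lambda,\mu))\mathfrak e_\mu$. $S_{L,k}$ is the space of holomorphic $f:\mathbb H\to\mathbb C[D]$ with $f(\gamma\tau)=\phi(\tau)^{2k}\rho_L(\gamma,\phi)f(\tau)$ for $(\gamma,\phi)\in\mathrm{Mp}_2(\mathbb Z)$ and expansion $f=\sum_{\lambda\in D}\sum_{n\in\bar q(\lambda)+\mathbb Z,\,n>0}a(\lambda,n)e(n\tau)\mathfrak e_\lambda$. **Hecke operators.** For scalar $h$ put $(h|_k(\gamma,\phi))(\tau)=\det(\gamma)^{k/2}\phi(\tau)^{-2k}h(\gamma\tau)$. Let $g(m^2)=(\begin{pmatrix}m^2&0\\0&1\end{pmatrix},1)$. Right action on $\mathbb C[D]$: $\mathfrak e_\lambda|_D\gamma=\rho_L(\gamma)^{-1}\mathfrak e_\lambda$ for $\gamma\in\mathrm{Mp}_2(\mathbb Z)$, $\mathfrak e_\lambda|_Dg(m^2)=\mathfrak e_{m\lambda}$, and $\mathfrak e_\lambda|_D(\gamma g(m^2)\gamma')=\mathfrak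 e_\lambda|_D\gamma|_Dg(m^2)|_D\gamma'$ (known to be well defined). For $\mathrm{Mp}_2(\mathbb Z)g(m^2)\mathrm{Mp}_2(\mathbb Z)=\bigsqcup_i\mathrm{Mp}_2(\mathbb Z)\delta_i$ set $f|_{L,k}T(m^2)=m^{k-2}\sum_i\sum_\lambda(f_\lambda|_k\delta_i)\otimes(\mathfrak e_\lambda|_D\delta_i)$.
   Formalization: The formal statement assumes m > 1: for m = 1 the operator T(1) is the identity, so Λ_1 = 1 equals the right-hand side and the strict inequality fails (e.g. L = E8, k = 12, f = Δ); for m = 0 the element g(0) is not invertible. *)

theory Defs
  imports "HOL-Analysis.Analysis" "HOL-Algebra.Generated_Groups" "HOL-Algebra.Bij"
    "HOL-Computational_Algebra.Primes"
begin

section \<open>Even lattices and their discriminant forms\<close>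

text \<open>A lattice is realised inside the real vector space \<open>span L\<close>, which plays the role of
  \<open>L \<otimes> \<real>\<close>; the ambient type may be larger, so every rank (also rank 0) occurs.
  Only the values of the form on \<open>span L\<close> matter.\<close>

definition int_span :: "'a::real_vector set \<Rightarrow> 'a set" where
  "int_span B = {\<Sum>b\<in>B. of_int (c b) *\<^sub>R b | c. True}"

definition even_lattice :: "'a::real_vector set \<Rightarrow> ('a \<Rightarrow> 'a \<Rightarrow> real) \<Rightarrow> bool" where
  "even_lattice L \<beta> \<longleftrightarrow>
     (\<exists>B. finite B \<and> independent B \<and> L = int_span B) \<and>
     bilinear \<beta> \<and> (\<forall>x y. \<beta> x y = \<beta> y x) \<and>
     (\<forall>x\<in>L. \<forall>y\<in>L. \<beta> x y \<in> \<int>) \<and>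
     (\<forall>x\<in>L. \<beta> x x / 2 \<in> \<int>) \<and>
     (\<forall>x\<in>L. (\<forall>y\<in>L. \<beta> x y = 0) \<longrightarrow> x = 0)"

definition pos_index :: "'a::real_vector set \<Rightarrow> ('a \<Rightarrow> 'a \<Rightarrow> real) \<Rightarrow> nat" where
  "pos_index L \<beta> =
     Max {dim W | W. subspace W \<and> W \<subseteq> span L \<and> (\<forall>x\<in>W. x \<noteq> 0 \<longrightarrow> \<beta> x x > 0)}"

definition lattice_sig :: "'a::real_vector set \<Rightarrow> ('a \<Rightarrow> 'a \<Rightarrow> real) \<Rightarrow> int" where
  "lattice_sig L \<beta> = int (pos_index L \<beta>) - int (pos_index L (\<lambda>x y. - \<beta> x y))"

definition dual_lattice :: "'a::real_vector set \<Rightarrow> ('a \<Rightarrow> 'a \<Rightarrow> real) \<Rightarrow> 'a set" where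
  "dual_lattice L \<beta> = {x \<in> span L. \<forall>y\<in>L. \<beta> x y \<in> \<int>}"

text \<open>The additive group \<open>L'/L\<close>, in the multiplicative notation of \<open>HOL-Algebra\<close>:
  the element \<open>m \<cdot> \<xi>\<close> is written \<open>\<xi> [^] m\<close>.\<close>

definition disc_group :: "'a::real_vector set \<Rightarrow> ('a \<Rightarrow> 'a \<Rightarrow> real) \<Rightarrow> 'a set monoid" where
  "disc_group L \<beta> = \<lparr>carrier = dual_lattice L \<beta>, mult = (+), one = 0\<rparr> Mod L"

abbreviation disc_carrier :: "'a::real_vector set \<Rightarrow> ('a \<Rightarrow> 'a \<Rightarrow> real) \<Rightarrow> 'a set set" where
  "disc_carrier L \<beta> \<equiv> carrier (disc_group L \<beta>)"

definition torsion :: "'a::real_vector set \<Rightarrow> ('a \<Rightarrow> 'a \<Rightarrow> real) \<Rightarrow> nat \<Rightarrow> 'a set set" where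
  "torsion L \<beta> m = {\<xi> \<in> disc_carrier L \<beta>. \<xi> [^]\<^bsub>disc_group L \<beta>\<^esub> m = \<one>\<^bsub>disc_group L \<beta>\<^esub>}"

text \<open>Elements of \<open>\<rat>/\<int>\<close> are represented by real numbers, obtained from chosen
  representatives of the cosets. The values below are therefore meaningful modulo \<open>\<int>\<close>
  only, and are only used modulo \<open>\<int>\<close>.\<close>

definition disc_form :: "('a::real_vector \<Rightarrow> 'a \<Rightarrow> real) \<Rightarrow> 'a set \<Rightarrow> 'a set \<Rightarrow> real" where
  "disc_form \<beta> \<xi> \<mu> = \<beta> (SOME x. x \<in> \<xi>) (SOME y. y \<in> \<mu>)"

definition disc_quad :: "('a::real_vector \<Rightarrow> 'a \<Rightarrow> real) \<Rightarrow> 'a set \<Rightarrow> real" where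
  "disc_quad \<beta> \<xi> = disc_form \<beta> \<xi> \<xi> / 2"


section \<open>The metaplectic group\<close>

definition upper_half :: "complex set" where
  "upper_half = {\<tau>. Im \<tau> > 0}"

definition moebius :: "real^2^2 \<Rightarrow> complex \<Rightarrow> complex" where
  "moebius \<gamma> \<tau> = (of_real (\<gamma>$1$1) * \<tau> + of_real (\<gamma>$1$2)) / (of_real (\<gamma>$2$1) * \<tau> + of_real (\<gamma>$2$2))"

text \<open>The functions \<open>\<phi>\<close> are extensional, i.e. they take a fixed dummy value outside the upper
  half plane, so that equality of pairs is equality of functions on the upper half plane.\<close>

type_synonym mp = "(real^2^2) \<times> (complex \<Rightarrow> complex)"

definition GL2_cover :: "mp monoid" where
  "GL2_cover = \<lparr>
     carrier = {(\<gamma>, \<phi>). det \<gamma> > 0 \<and> \<phi> \<in> extensional upper_half \<and> \<phi> holomorphic_on upper_half \<and>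
                  (\<forall>\<tau>\<in>upper_half. (\<phi> \<tau>)\<^sup>2 = of_real (\<gamma>$2$1) * \<tau> + of_real (\<gamma>$2$2))},
     mult = (\<lambda>(\<gamma>, \<phi>) (\<gamma>', \<phi>'). (\<gamma> ** \<gamma>', \<lambda>\<tau>\<in>upper_half. \<phi> (moebius \<gamma>' \<tau>) * \<phi>' \<tau>)),
     one = (mat 1, \<lambda>\<tau>\<in>upper_half. 1)\<rparr>"

definition Mp2Z :: "mp set" where
  "Mp2Z = {(\<gamma>, \<phi>) \<in> carrier GL2_cover. det \<gamma> = 1 \<and> (\<forall>i j. \<gamma>$i$j \<in> \<int>)}"

definition T_bar :: mp where
  "T_bar = (vector [vector [1, 1], vector [0, 1]], \<lambda>\<tau>\<in>upper_half. 1)"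

definition S_bar :: mp where
  "S_bar = (vector [vector [0, -1], vector [1, 0]], \<lambda>\<tau>\<in>upper_half. csqrt \<tau>)"

definition g_sq :: "nat \<Rightarrow> mp" where
  "g_sq m = (vector [vector [real (m^2), 0], vector [0, 1]], \<lambda>\<tau>\<in>upper_half. 1)"


section \<open>The Weil representation\<close>

definition e :: "complex \<Rightarrow> complex" where
  "e x = exp (2 * of_real pi * \<i> * x)"

text \<open>An element \<open>\<Sum>\<xi>\<in>D. v \<xi> * ebasis \<xi>\<close> of \<open>\<complex>[D]\<close> is its coefficient function,
  extended by zero outside \<open>D\<close>.\<close>

definition group_algebra ::
    "'a::real_vector set \<Rightarrow> ('a \<Rightarrow> 'a \<Rightarrow> real) \<Rightarrow> ('a set \<Rightarrow> complex) set" where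
  "group_algebra L \<beta> = {v. \<forall>\<xi>. \<xi> \<notin> disc_carrier L \<beta> \<longrightarrow> v \<xi> = 0}"

definition ebasis :: "'a set \<Rightarrow> 'a set \<Rightarrow> complex" where
  "ebasis \<xi> = (\<lambda>\<mu>. if \<mu> = \<xi> then 1 else 0)"

text \<open>The linear endomorphism of \<open>\<complex>[D]\<close> with prescribed values on the basis.\<close>

definition lin_ext ::
    "'a::real_vector set \<Rightarrow> ('a \<Rightarrow> 'a \<Rightarrow> real) \<Rightarrow> ('a set \<Rightarrow> 'a set \<Rightarrow> complex) \<Rightarrow>
     ('a set \<Rightarrow> complex) \<Rightarrow> 'a set \<Rightarrow> complex" where
  "lin_ext L \<beta> F = (\<lambda>v \<in> group_algebra L \<beta>. \<lambda>\<mu>. \<Sum>\<xi> \<in> disc_carrier L \<beta>. v \<xi> * F \<xi> \<mu>)"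

definition weil_T ::
    "'a::real_vector set \<Rightarrow> ('a \<Rightarrow> 'a \<Rightarrow> real) \<Rightarrow> ('a set \<Rightarrow> complex) \<Rightarrow> 'a set \<Rightarrow> complex" where
  "weil_T L \<beta> = lin_ext L \<beta> (\<lambda>\<xi> \<nu>. e (of_real (disc_quad \<beta> \<xi>)) * ebasis \<xi> \<nu>)"

definition weil_S ::
    "'a::real_vector set \<Rightarrow> ('a \<Rightarrow> 'a \<Rightarrow> real) \<Rightarrow> ('a set \<Rightarrow> complex) \<Rightarrow> 'a set \<Rightarrow> complex" where
  "weil_S L \<beta> = lin_ext L \<beta> (\<lambda>\<xi> \<nu>.
     e (- of_int (lattice_sig L \<beta>) / 8) / of_real (sqrt (real (card (disc_carrier L \<beta>)))) *
     (\<Sum>\<mu> \<in> disc_carrier L \<beta>. e (- of_real (disc_form \<beta> \<xi> \<mu>)) * ebasis \<mu> \<nu>))"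

text \<open>\<open>Mp2Z\<close> is generated by \<open>T_bar\<close> and \<open>S_bar\<close>, so the graph of the homomorphism determined
  by its values on these elements is the subgroup of the product group generated by
  the two pairs (element, value). It is classical that this subgroup is the graph of a function;
  hence the choice operator below selects the unique possible value.\<close>

definition weil_graph ::
    "'a::real_vector set \<Rightarrow> ('a \<Rightarrow> 'a \<Rightarrow> real) \<Rightarrow>
     (mp \<times> (('a set \<Rightarrow> complex) \<Rightarrow> 'a set \<Rightarrow> complex)) set" where
  "weil_graph L \<beta> =
     generate (GL2_cover\<lparr>carrier := Mp2Z\<rparr> \<times>\<times> BijGroup (group_algebra L \<beta>))
       {(T_bar, weil_T L \<beta>), (S_bar, weil_S L \<beta>)}"

definition weil_rep ::
    "'a::real_vector set \<Rightarrow> ('a \<Rightarrow> 'a \<Rightarrow> real) \<Rightarrow> mp \<Rightarrow> ('a set \<Rightarrow> complex) \<Rightarrow> 'a set \<Rightarrow> complex" where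
  "weil_rep L \<beta> \<gamma> = (SOME A. (\<gamma>, A) \<in> weil_graph L \<beta>)"


section \<open>Vector-valued cusp forms\<close>

text \<open>The weight \<open>k\<close> is a real number with \<open>2k\<close> an integer.\<close>

definition cusp_forms ::
    "'a::real_vector set \<Rightarrow> ('a \<Rightarrow> 'a \<Rightarrow> real) \<Rightarrow> real \<Rightarrow> (complex \<Rightarrow> 'a set \<Rightarrow> complex) set" where
  "cusp_forms L \<beta> k = {f.
     (\<forall>\<tau>\<in>upper_half. f \<tau> \<in> group_algebra L \<beta>) \<and>
     (\<forall>\<xi>\<in>disc_carrier L \<beta>. (\<lambda>\<tau>. f \<tau> \<xi>) holomorphic_on upper_half) \<and>
     (\<forall>(\<gamma>, \<phi>)\<in>Mp2Z. \<forall>\<tau>\<in>upper_half.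
        f (moebius \<gamma> \<tau>) = (\<lambda>\<mu>. \<phi> \<tau> powi \<lfloor>2 * k\<rfloor> * weil_rep L \<beta> (\<gamma>, \<phi>) (f \<tau>) \<mu>)) \<and>
     (\<exists>a. \<forall>\<xi>\<in>disc_carrier L \<beta>. \<forall>\<tau>\<in>upper_half.
        ((\<lambda>n. a \<xi> n * e (of_real n * \<tau>)) has_sum f \<tau> \<xi>)
          {n::real. n - disc_quad \<beta> \<xi> \<in> \<int> \<and> n > 0})}"


section \<open>Hecke operators\<close>

definition slash :: "real \<Rightarrow> mp \<Rightarrow> (complex \<Rightarrow> complex) \<Rightarrow> complex \<Rightarrow> complex" where
  "slash k = (\<lambda>(\<gamma>, \<phi>) h \<tau>. of_real (det \<gamma> powr (k / 2)) * \<phi> \<tau> powi (- \<lfloor>2 * k\<rfloor>) * h (moebius \<gamma> \<tau>))"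

definition act_Mp2Z ::
    "'a::real_vector set \<Rightarrow> ('a \<Rightarrow> 'a \<Rightarrow> real) \<Rightarrow> mp \<Rightarrow> ('a set \<Rightarrow> complex) \<Rightarrow> 'a set \<Rightarrow> complex" where
  "act_Mp2Z L \<beta> \<gamma> = inv\<^bsub>BijGroup (group_algebra L \<beta>)\<^esub> (weil_rep L \<beta> \<gamma>)"

definition act_g_sq ::
    "'a::real_vector set \<Rightarrow> ('a \<Rightarrow> 'a \<Rightarrow> real) \<Rightarrow> nat \<Rightarrow> ('a set \<Rightarrow> complex) \<Rightarrow> 'a set \<Rightarrow> complex" where
  "act_g_sq L \<beta> m = lin_ext L \<beta> (\<lambda>\<xi>. ebasis (\<xi> [^]\<^bsub>disc_group L \<beta>\<^esub> m))"

text \<open>The right action of \<open>\<delta> = \<gamma> g(m\<^sup>2) \<gamma>'\<close>, in which \<open>\<gamma>\<close> acts first; it is known not to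
  depend on the chosen decomposition.\<close>

definition act_double ::
    "'a::real_vector set \<Rightarrow> ('a \<Rightarrow> 'a \<Rightarrow> real) \<Rightarrow> nat \<Rightarrow> mp \<Rightarrow>
     ('a set \<Rightarrow> complex) \<Rightarrow> 'a set \<Rightarrow> complex" where
  "act_double L \<beta> m \<delta> v =
     (let (\<gamma>, \<gamma>') = (SOME (\<gamma>, \<gamma>'). \<gamma> \<in> Mp2Z \<and> \<gamma>' \<in> Mp2Z \<and>
                        \<delta> = \<gamma> \<otimes>\<^bsub>GL2_cover\<^esub> g_sq m \<otimes>\<^bsub>GL2_cover\<^esub> \<gamma>')
      in act_Mp2Z L \<beta> \<gamma>' (act_g_sq L \<beta> m (act_Mp2Z L \<beta> \<gamma> v)))"

definition double_coset :: "nat \<Rightarrow> mp set" where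
  "double_coset m =
     {\<gamma> \<otimes>\<^bsub>GL2_cover\<^esub> g_sq m \<otimes>\<^bsub>GL2_cover\<^esub> \<gamma>' | \<gamma> \<gamma>'. \<gamma> \<in> Mp2Z \<and> \<gamma>' \<in> Mp2Z}"

definition hecke_cosets :: "nat \<Rightarrow> mp set set" where
  "hecke_cosets m = {Mp2Z #>\<^bsub>GL2_cover\<^esub> \<delta> | \<delta>. \<delta> \<in> double_coset m}"

text \<open>The sum runs over the cosets \<open>C = Mp2Z \<delta>\<^sub>i\<close> with a chosen representative of each.\<close>

definition hecke ::
    "'a::real_vector set \<Rightarrow> ('a \<Rightarrow> 'a \<Rightarrow> real) \<Rightarrow> real \<Rightarrow> nat \<Rightarrow>
     (complex \<Rightarrow> 'a set \<Rightarrow> complex) \<Rightarrow> complex \<Rightarrow> 'a set \<Rightarrow> complex" where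
  "hecke L \<beta> k m f \<tau> = (\<lambda>\<mu>. of_real (real m powr (k - 2)) *
     (\<Sum>C \<in> hecke_cosets m. let \<delta> = (SOME \<delta>. \<delta> \<in> C) in
        \<Sum>\<xi> \<in> disc_carrier L \<beta>.
          slash k \<delta> (\<lambda>z. f z \<xi>) \<tau> * act_double L \<beta> m \<delta> (ebasis \<xi>) \<mu>))"

definition hecke_eigenform ::
    "'a::real_vector set \<Rightarrow> ('a \<Rightarrow> 'a \<Rightarrow> real) \<Rightarrow> real \<Rightarrow> nat \<Rightarrow>
     (complex \<Rightarrow> 'a set \<Rightarrow> complex) \<Rightarrow> complex \<Rightarrow> bool" where
  "hecke_eigenform L \<beta> k m f \<Lambda> \<longleftrightarrow>
     f \<in> cusp_forms L \<beta> k \<and>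
     (\<exists>\<tau>\<in>upper_half. f \<tau> \<noteq> (\<lambda>_. 0)) \<and>
     (\<forall>\<tau>\<in>upper_half. hecke L \<beta> k m f \<tau> = (\<lambda>\<mu>. \<Lambda> * f \<tau> \<mu>))"

end

theory Submission
  imports Defs "HOL-Real_Asymp.Real_Asymp"
begin

text \<open>The Petersson function \<open>pet \<tau> = Im \<tau> powr (k / 2) * nrm (f \<tau>)\<close> is invariant under
  \<open>Mp2Z\<close>, because the Weil representation is unitary, and it tends to zero at the cusp; hence it
  attains its maximum. Each summand of the Hecke operator, scaled by \<open>Im \<tau> powr (k / 2)\<close>, has
  norm at most \<open>sqrt t * pet (\<delta> \<tau>)\<close>, where \<open>t\<close> is the order of the \<open>m\<close>-torsion: multiplication
  by \<open>m\<close> on the discriminant group has fibres of size at most \<open>t\<close>, and the Cauchy-Schwarz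
  inequality gives the factor \<open>sqrt t\<close>. Evaluation at a maximum gives the bound with \<open>\<le>\<close>. If
  equality held at every maximum \<open>\<tau>\<close>, then \<open>m\<^sup>2 \<tau>\<close> would again be a maximum, hence so would
  all its iterates, which tend to the cusp, contradicting the decay there.

  The cosets are counted by the Hermite normal form: each one has a representative with upper
  triangular primitive integral matrix of determinant \<open>m\<^sup>2\<close>.\<close>

text \<open>Several objects in the statement are produced by \<open>SOME\<close>: the value of
  \<open>weil_rep\<close>, the decomposition in \<open>act_double\<close>, the representative of
  each coset. Every estimate is therefore proved for all admissible choices. For
  \<open>weil_rep\<close> this means that all second components of \<open>weil_graph\<close> lie in
  the subgroup of linear isometries, since the two generators do, and that the graph reaches every
  element of \<open>Mp2Z\<close>, i.e. that \<open>T_bar\<close> and \<open>S_bar\<close> generate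
  it. The Euclidean reduction behind this also yields the Hermite normal form of the cosets. The
  isometry at \<open>S_bar\<close> is orthogonality of the characters of \<open>L'/L\<close>, which
  rests on finiteness of this group and nondegeneracy of its pairing; both are read off from a dual
  basis with integer denominators. A strict inequality is required even when the torsion is trivial
  and \<open>sqrt t = t\<close>, so strictness has to come from a summand of the Hecke operator: the
  coset of \<open>g_sq m\<close> must be shown to miss the maximum of the Petersson
  function.\<close>

section \<open>The discriminant group\<close>

text \<open>Pigeonhole: with \<open>n = card B\<close>, the map \<open>(v, t) \<mapsto> v g + t b0\<close> sends a box of integer points
  in dimension \<open>n + 1\<close> to a box with fewer points in dimension \<open>n\<close>; a collision must involve two
  different \<open>t\<close>, since \<open>g\<close> is injective.\<close>

lemma gram_dual_vector:
  fixes g :: "'b \<Rightarrow> 'b \<Rightarrow> int"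
  assumes fin: "finite B" and b0: "b0 \<in> B"
    and nd: "\<forall>v :: 'b \<Rightarrow> int. (\<forall>b\<in>B. (\<Sum>c\<in>B. v c * g c b) = 0) \<longrightarrow> (\<forall>b\<in>B. v b = 0)"
  obtains N :: int and v :: "'b \<Rightarrow> int" where "N \<noteq> 0"
    "\<And>b. b \<in> B \<Longrightarrow> (\<Sum>c\<in>B. v c * g c b) = (if b = b0 then N else 0)"
proof -
  \<comment> \<open>The summand 1 leaves room for \<open>t\<close>: each coordinate of the image is
    at most \<open>K * (C - 1) + K = K * C\<close> in absolute value.\<close>
  define C where "C = (\<Sum>b\<in>B. \<Sum>c\<in>B. \<bar>g c b\<bar>) + 1"
  have C1: "C \<ge> 1" unfolding C_def by (simp add: sum_nonneg)
  define n where "n = card B"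
  \<comment> \<open>Chosen so that \<open>(2 * K * C + 1) ^ n \<le> (2 * C * (K + 1)) ^ n = K * (K +
    1) ^ n\<close>, which is less than \<open>(K + 1) ^ (n + 1)\<close>, the number of points in the
    source.\<close>
  define K where "K = (2 * C) ^ n"
  have K1: "K \<ge> 1" unfolding K_def using C1 by (intro one_le_power) simp
  define h where "h = (\<lambda>(v, t). \<lambda>b\<in>B. (\<Sum>c\<in>B. v c * g c b) + (if b = b0 then t else 0))"
  define X where "X = (B \<rightarrow>\<^sub>E {0..K}) \<times> {0..K}"
  define Y where "Y = (B \<rightarrow>\<^sub>E {-(K*C)..K*C})"
  have finX: "finite X" and finY: "finite Y"
    unfolding X_def Y_def using fin by (auto intro!: finite_PiE)
  have sub: "h ` X \<subseteq> Y"
  proof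
    fix y assume "y \<in> h ` X"
    then obtain v t where v: "v \<in> B \<rightarrow>\<^sub>E {0..K}" and t: "t \<in> {0..K}" and y: "y = h (v, t)"
      by (auto simp: X_def)
    define s where "s = (\<lambda>b. (\<Sum>c\<in>B. v c * g c b) + (if b = b0 then t else 0))"
    have "\<bar>s b\<bar> \<le> K * C" if b: "b \<in> B" for b
    proof -
      have "\<bar>\<Sum>c\<in>B. v c * g c b\<bar> \<le> (\<Sum>c\<in>B. \<bar>v c * g c b\<bar>)" by (rule sum_abs)
      also have "\<dots> \<le> (\<Sum>c\<in>B. K * \<bar>g c b\<bar>)"
      proof (rule sum_mono)
        fix c assume "c \<in> B"
        then have "v c \<in> {0..K}" using v by auto
        then show "\<bar>v c * g c b\<bar> \<le> K * \<bar>g c b\<bar>" by (auto simp: abs_mult intro: mult_right_mono)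
      qed
      also have "\<dots> = K * (\<Sum>c\<in>B. \<bar>g c b\<bar>)" by (simp add: sum_distrib_left)
      also have "\<dots> \<le> K * (\<Sum>b\<in>B. \<Sum>c\<in>B. \<bar>g c b\<bar>)"
        using K1 fin b by (intro mult_left_mono member_le_sum[of b B "\<lambda>b. \<Sum>c\<in>B. \<bar>g c b\<bar>"])
          (auto simp: sum_nonneg)
      finally show ?thesis using t K1 by (auto simp: s_def C_def algebra_simps split: if_splits)
    qed
    then have "restrict s B \<in> Y" unfolding Y_def by (simp add: PiE_iff abs_le_iff minus_le_iff[of "s _"])
    then show "y \<in> Y" by (simp add: y h_def s_def)
  qed
  have "card Y < card X"
  proof -
    have cX: "int (card X) = (K + 1) ^ (n + 1)"
      unfolding X_def using K1 fin by (simp add: card_cartesian_product card_PiE n_def)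
    have cY: "int (card Y) = (2 * (K * C) + 1) ^ n"
      unfolding Y_def using K1 C1 fin by (simp add: card_PiE n_def mult.commute)
    have "(2 * (K * C) + 1) ^ n \<le> (2 * C * (K + 1)) ^ n"
      using K1 C1 by (intro power_mono) (auto simp: algebra_simps)
    also have "\<dots> = K * (K + 1) ^ n" by (simp add: K_def power_mult_distrib)
    also have "\<dots> < (K + 1) ^ (n + 1)" using K1 by simp
    finally show ?thesis using cX cY by simp
  qed
  then have "\<not> inj_on h X" using card_inj_on_le[OF _ sub finY] by auto
  then obtain v t v' t' where X: "(v, t) \<in> X" "(v', t') \<in> X" and eq: "h (v, t) = h (v', t')"
    and ne: "(v, t) \<noteq> (v', t')" unfolding inj_on_def by fastforce
  have eqb: "(\<Sum>c\<in>B. (v c - v' c) * g c b) = (if b = b0 then t' - t else 0)" if "b \<in> B" for b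
    using fun_cong[OF eq, of b] that by (auto simp: h_def left_diff_distrib sum_subtractf split: if_splits)
  have "t' - t \<noteq> 0"
  proof
    assume t0: "t' - t = 0"
    have "v c - v' c = 0" if "c \<in> B" for c
      using nd[rule_format, of "\<lambda>c. v c - v' c" c] eqb that t0 by auto
    then have "v c = v' c" for c using X by (cases "c \<in> B") (auto simp: X_def PiE_def extensional_def)
    then have "v = v'" by auto
    then show False using ne t0 by auto
  qed
  then show thesis using eqb that[of "t' - t" "\<lambda>c. v c - v' c"] by auto
qed

section \<open>Character sums and power maps of groups, and the function \<open>e\<close>\<close>

text \<open>Translation by \<open>\<nu>\<close> permutes the group and multiplies the sum by
  \<open>\<psi> \<nu>\<close>, which is not 1.\<close>

lemma sum_character_eq_0:
  fixes \<psi> :: "'g \<Rightarrow> complex"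
  assumes "group G" "\<nu> \<in> carrier G" "\<psi> \<nu> \<noteq> 1"
    and mult: "\<And>\<mu>. \<mu> \<in> carrier G \<Longrightarrow> \<psi> (\<nu> \<otimes>\<^bsub>G\<^esub> \<mu>) = \<psi> \<nu> * \<psi> \<mu>"
  shows "(\<Sum>\<mu>\<in>carrier G. \<psi> \<mu>) = 0"
proof -
  interpret group G by fact
  have "bij_betw (\<lambda>\<mu>. \<nu> \<otimes>\<^bsub>G\<^esub> \<mu>) (carrier G) (carrier G)"
  proof -
    have "inj_on (\<lambda>\<mu>. \<nu> \<otimes>\<^bsub>G\<^esub> \<mu>) (carrier G)" using assms(2) by (simp add: inj_on_cmult)
    then show ?thesis using surj_const_mult[OF assms(2)] by (simp add: bij_betw_def)
  qed
  then have "(\<Sum>\<mu>\<in>carrier G. \<psi> (\<nu> \<otimes>\<^bsub>G\<^esub> \<mu>)) = (\<Sum>\<mu>\<in>carrier G. \<psi> \<mu>)"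
    by (rule sum.reindex_bij_betw)
  moreover have "(\<Sum>\<mu>\<in>carrier G. \<psi> (\<nu> \<otimes>\<^bsub>G\<^esub> \<mu>)) = \<psi> \<nu> * (\<Sum>\<mu>\<in>carrier G. \<psi> \<mu>)"
    by (simp add: mult sum_distrib_left)
  ultimately have "(\<psi> \<nu> - 1) * (\<Sum>\<mu>\<in>carrier G. \<psi> \<mu>) = 0" by (simp add: algebra_simps)
  then show ?thesis using assms(3) by simp
qed

text \<open>Dividing by one element of a nonempty fibre moves the fibre injectively into the kernel
  of the power map.\<close>

lemma card_pow_fibre_le:
  assumes "comm_group G" "finite (carrier G)"
  shows "card {x \<in> carrier G. x [^]\<^bsub>G\<^esub> (n::nat) = y} \<le> card {x \<in> carrier G. x [^]\<^bsub>G\<^esub> n = \<one>\<^bsub>G\<^esub>}"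
proof -
  interpret comm_group G by fact
  show ?thesis
  proof (cases "{x \<in> carrier G. x [^]\<^bsub>G\<^esub> n = y} = {}")
    case False
    then obtain z where z: "z \<in> carrier G" "z [^]\<^bsub>G\<^esub> n = y" by auto
    show ?thesis
    proof (rule card_inj_on_le[where f = "\<lambda>x. inv\<^bsub>G\<^esub> z \<otimes>\<^bsub>G\<^esub> x"])
      show "inj_on (\<lambda>x. inv\<^bsub>G\<^esub> z \<otimes>\<^bsub>G\<^esub> x) {x \<in> carrier G. x [^]\<^bsub>G\<^esub> n = y}"
        using z by (auto simp: inj_on_def)
      show "(\<lambda>x. inv\<^bsub>G\<^esub> z \<otimes>\<^bsub>G\<^esub> x) ` {x \<in> carrier G. x [^]\<^bsub>G\<^esub> n = y}
          \<subseteq> {x \<in> carrier G. x [^]\<^bsub>G\<^esub> n = \<one>\<^bsub>G\<^esub>}"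
        using z by (auto simp: pow_mult_distrib m_comm nat_pow_inv)
      show "finite {x \<in> carrier G. x [^]\<^bsub>G\<^esub> n = \<one>\<^bsub>G\<^esub>}" using assms(2) by simp
    qed
  next
    case True
    then show ?thesis by (metis card.empty le0)
  qed
qed

lemma e_add: "e (x + y) = e x * e y"
  by (simp add: e_def distrib_left exp_add)

lemma e_of_int: "x \<in> \<int> \<Longrightarrow> e (of_real x) = 1"
  by (auto simp: e_def elim!: Ints_cases) (metis exp_2pi_1_int mult.commute mult.left_commute)

lemma e_eq_1_iff: "e (of_real x) = 1 \<longleftrightarrow> x \<in> \<int>"
proof
  assume "e (of_real x) = 1"
  then obtain n :: int where "2 * pi * x = of_int (2 * n) * pi"
    by (auto simp: e_def exp_eq_1)
  then have "x = of_int n" by simp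
  then show "x \<in> \<int>" by simp
qed (rule e_of_int)

text \<open>\<open>disc_form\<close> and \<open>disc_quad\<close> are meaningful only modulo the
  integers; this removes the ambiguity once \<open>e\<close> is applied.\<close>

lemma e_cong: "x - y \<in> \<int> \<Longrightarrow> e (of_real x) = e (of_real y)"
  using e_add[of "of_real (x - y)" "of_real y"] e_of_int[of "x - y"] by simp

lemma cmod_e_of_real: "cmod (e (of_real x)) = 1"
proof -
  have "2 * of_real pi * \<i> * of_real x = \<i> * of_real (2 * pi * x)" by simp
  then show ?thesis unfolding e_def by (metis norm_exp_i_times)
qed

section \<open>Dual bases and the finite group \<open>L'/L\<close>\<close>

locale even_lattice_form =
  fixes L :: "'a::real_vector set" and \<beta> :: "'a \<Rightarrow> 'a \<Rightarrow> real"
  assumes even: "even_lattice L \<beta>"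
begin

lemma bilin: "bilinear \<beta>" and form_sym: "\<beta> x y = \<beta> y x"
  using even by (auto simp: even_lattice_def)

lemma lin_left: "linear (\<lambda>x. \<beta> x y)" and lin_right: "linear (\<beta> x)"
  using bilin by (auto simp: bilinear_def)

lemmas form_simps = bilinear_ladd[OF bilin] bilinear_radd[OF bilin] bilinear_lmul[OF bilin]
  bilinear_rmul[OF bilin] bilinear_lneg[OF bilin] bilinear_rneg[OF bilin]
  bilinear_lsub[OF bilin] bilinear_rsub[OF bilin] bilinear_lzero[OF bilin] bilinear_rzero[OF bilin]

lemma int_valued: "x \<in> L \<Longrightarrow> y \<in> L \<Longrightarrow> \<beta> x y \<in> \<int>"
  using even by (auto simp: even_lattice_def)

text \<open>The vectors \<open>bs b\<close> form the basis of the real span that is dual to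
  \<open>B\<close> under \<open>\<beta>\<close>. Nondegeneracy is given for lattice vectors only, so
  they are found over the integers: \<open>gram_dual_vector\<close> supplies a lattice vector
  orthogonal to every element of \<open>B\<close> except \<open>b\<close>, and \<open>N b\<close> is
  the denominator that turns it into \<open>bs b\<close>. These denominators later bound
  \<open>L'/L\<close>.\<close>

lemma dual_basis:
  obtains B bs and N :: "'a \<Rightarrow> int" where
    "finite B" "L = int_span B"
    "\<And>b. b \<in> B \<Longrightarrow> N b \<noteq> 0" "\<And>b. b \<in> B \<Longrightarrow> of_int (N b) *\<^sub>R bs b \<in> L"
    "\<And>b. b \<in> B \<Longrightarrow> bs b \<in> dual_lattice L \<beta>"
    "\<And>x. x \<in> span L \<Longrightarrow> x = (\<Sum>b\<in>B. \<beta> x (bs b) *\<^sub>R b)"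
proof -
  obtain B where B: "finite B" "independent B" "L = int_span B"
    using even by (auto simp: even_lattice_def)
  have BL: "b \<in> L" if "b \<in> B" for b
  proof -
    have "(\<Sum>c\<in>B. of_int (if c = b then 1 else 0) *\<^sub>R c) = (\<Sum>c\<in>B. if c = b then c else 0)"
      by (intro sum.cong) auto
    also have "\<dots> = b" using B(1) that by simp
    finally show ?thesis unfolding B(3) int_span_def by (auto intro!: exI[of _ "\<lambda>c. if c = b then 1 else 0"])
  qed
  define g where "g = (\<lambda>c b. \<lfloor>\<beta> c b\<rfloor>)"
  have g: "of_int (g c b) = \<beta> c b" if "c \<in> B" "b \<in> B" for c b
    using int_valued[OF BL BL] that by (simp add: g_def)
  have pair: "\<beta> (\<Sum>c\<in>B. of_int (v c) *\<^sub>R c) b = of_int (\<Sum>c\<in>B. v c * g c b)" if "b \<in> B" for v :: "'a \<Rightarrow> int" and b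
    using that by (simp add: linear_sum[OF lin_left] form_simps g)
  \<comment> \<open>An integer relation between the rows of the Gram matrix is a lattice vector
    orthogonal to all of \<open>L\<close>: nondegeneracy makes the vector zero, and independence of
    \<open>B\<close> makes its coefficients zero.\<close>
  have nd: "\<forall>v :: 'a \<Rightarrow> int. (\<forall>b\<in>B. (\<Sum>c\<in>B. v c * g c b) = 0) \<longrightarrow> (\<forall>b\<in>B. v b = 0)"
  proof (intro allI impI ballI)
    fix v :: "'a \<Rightarrow> int" and b assume v: "\<forall>b\<in>B. (\<Sum>c\<in>B. v c * g c b) = 0" and b: "b \<in> B"
    let ?x = "\<Sum>c\<in>B. of_int (v c) *\<^sub>R c"
    have "?x \<in> L" unfolding B(3) int_span_def by blast
    moreover have "\<beta> ?x y = 0" if y: "y \<in> L" for y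
    proof -
      obtain u :: "'a \<Rightarrow> int" where "y = (\<Sum>b\<in>B. of_int (u b) *\<^sub>R b)"
        using y unfolding B(3) int_span_def by blast
      then show ?thesis by (simp add: linear_sum[OF lin_right] form_simps pair v)
    qed
    ultimately have "?x = 0" using even by (auto simp: even_lattice_def)
    then show "v b = 0" using independentD[OF B(2,1) order.refl, of "\<lambda>c. of_int (v c)" b] b by simp
  qed
  have "\<exists>N x. N \<noteq> (0::int) \<and> x \<in> L \<and> (\<forall>b\<in>B. \<beta> x b = (if b = c then of_int N else 0))" if c: "c \<in> B" for c
  proof -
    obtain N v where "N \<noteq> 0" and v: "\<And>b. b \<in> B \<Longrightarrow> (\<Sum>a\<in>B. v a * g a b) = (if b = c then N else 0)"
      by (rule gram_dual_vector[OF B(1) c nd]) (rule that; assumption)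
    then have "\<forall>b\<in>B. \<beta> (\<Sum>c\<in>B. of_int (v c) *\<^sub>R c) b = (if b = c then of_int N else 0)"
      by (simp add: pair)
    moreover have "(\<Sum>c\<in>B. of_int (v c) *\<^sub>R c) \<in> L" unfolding B(3) int_span_def by blast
    ultimately show ?thesis using \<open>N \<noteq> 0\<close> by blast
  qed
  then obtain N as where as: "\<And>c. c \<in> B \<Longrightarrow> N c \<noteq> (0::int) \<and> as c \<in> L \<and>
      (\<forall>b\<in>B. \<beta> (as c) b = (if b = c then of_int (N c) else 0))" by metis
  define bs where "bs = (\<lambda>c. (1 / of_int (N c)) *\<^sub>R as c)"
  have bs: "\<beta> (bs c) b = (if b = c then 1 else 0)" if "b \<in> B" "c \<in> B" for b c
    using as[OF that(2)] that by (auto simp: bs_def form_simps)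
  have coord: "\<beta> (bs c) (\<Sum>b\<in>B. u b *\<^sub>R b) = u c" if c: "c \<in> B" for u c
  proof -
    have "\<beta> (bs c) (\<Sum>b\<in>B. u b *\<^sub>R b) = (\<Sum>b\<in>B. u b * \<beta> (bs c) b)"
      by (simp add: linear_sum[OF lin_right] form_simps)
    also have "\<dots> = (\<Sum>b\<in>B. if b = c then u c else 0)"
      using bs c by (intro sum.cong) auto
    finally show ?thesis using B(1) c by simp
  qed
  have "L \<subseteq> span B" unfolding B(3) int_span_def by (auto intro: span_sum span_scale span_base)
  then have spanL: "span L = span B" using BL by (simp add: span_eq subset_iff span_base)
  have "x = (\<Sum>b\<in>B. \<beta> x (bs b) *\<^sub>R b)" if xL: "x \<in> span L" for x
  proof -
    obtain u where x: "x = (\<Sum>b\<in>B. u b *\<^sub>R b)" using xL B(1) by (auto simp: spanL span_finite)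
    have "\<beta> x (bs c) = u c" if c: "c \<in> B" for c
      unfolding x by (subst form_sym) (rule coord[OF c])
    then show ?thesis unfolding x by (auto intro!: sum.cong)
  qed
  moreover have "bs c \<in> dual_lattice L \<beta>" if c: "c \<in> B" for c
  proof -
    have "\<beta> (bs c) y \<in> \<int>" if y: "y \<in> L" for y
    proof -
      obtain u :: "'a \<Rightarrow> int" where "y = (\<Sum>b\<in>B. of_int (u b) *\<^sub>R b)"
        using y unfolding B(3) int_span_def by blast
      then show ?thesis using coord[OF c] by simp
    qed
    moreover have "bs c \<in> span L" using as[OF c] by (auto simp: bs_def intro: span_scale span_base)
    ultimately show ?thesis by (simp add: dual_lattice_def)
  qed
  moreover have "of_int (N c) *\<^sub>R bs c \<in> L" if "c \<in> B" for c
    using as[OF that] by (simp add: bs_def)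
  ultimately show thesis using as by (intro that[of B N bs] B) auto
qed

abbreviation "L' \<equiv> dual_lattice L \<beta>"
abbreviation "D \<equiv> disc_group L \<beta>"
abbreviation "G \<equiv> \<lparr>carrier = L', mult = (+), one = 0\<rparr>"

lemma lattice_diff: "x \<in> L \<Longrightarrow> y \<in> L \<Longrightarrow> x - y \<in> L" and lattice_zero: "0 \<in> L"
proof -
  obtain B where B: "L = int_span B" using even by (auto simp: even_lattice_def)
  show "x - y \<in> L" if xy: "x \<in> L" "y \<in> L"
  proof -
    obtain u v :: "'a \<Rightarrow> int" where "x = (\<Sum>b\<in>B. of_int (u b) *\<^sub>R b)" "y = (\<Sum>b\<in>B. of_int (v b) *\<^sub>R b)"
      using xy unfolding B int_span_def by blast
    then have "x - y = (\<Sum>b\<in>B. of_int (u b - v b) *\<^sub>R b)"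
      by (simp add: scaleR_left_diff_distrib sum_subtractf)
    then show ?thesis unfolding B int_span_def by (intro CollectI exI[of _ "\<lambda>b. u b - v b"] conjI TrueI)
  qed
  show "0 \<in> L" unfolding B int_span_def by (auto intro!: exI[of _ "\<lambda>_. 0"])
qed

lemma lattice_uminus: "x \<in> L \<Longrightarrow> - x \<in> L"
  using lattice_diff[OF lattice_zero, of x] by simp

lemma lattice_add: "x \<in> L \<Longrightarrow> y \<in> L \<Longrightarrow> x + y \<in> L"
  using lattice_diff[OF _ lattice_uminus, of x y] by simp

lemma lattice_subset_dual: "L \<subseteq> L'"
  by (auto simp: dual_lattice_def span_base int_valued)

lemma dual_int_left: "x \<in> L' \<Longrightarrow> y \<in> L \<Longrightarrow> \<beta> x y \<in> \<int>"
  and dual_int_right: "x \<in> L' \<Longrightarrow> y \<in> L \<Longrightarrow> \<beta> y x \<in> \<int>"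
  by (auto simp: dual_lattice_def form_sym[of y x])

lemma dual_add: "x \<in> L' \<Longrightarrow> y \<in> L' \<Longrightarrow> x + y \<in> L'"
  by (auto simp: dual_lattice_def span_add form_simps)

lemma dual_uminus: "x \<in> L' \<Longrightarrow> - x \<in> L'"
  by (auto simp: dual_lattice_def span_neg form_simps)

lemma dual_zero: "0 \<in> L'"
  by (auto simp: dual_lattice_def span_zero form_simps)

text \<open>The coordinates of \<open>x\<close> in \<open>B\<close> are its pairings with the dual
  basis, and these are integers by assumption. This is the source of nondegeneracy on
  \<open>L'/L\<close>.\<close>

lemma dual_dual:
  assumes x: "x \<in> L'" and int: "\<And>y. y \<in> L' \<Longrightarrow> \<beta> x y \<in> \<int>"
  shows "x \<in> L"
proof -
  obtain B bs and N :: "'a \<Rightarrow> int" where B: "finite B" "L = int_span B"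
    "\<And>b. b \<in> B \<Longrightarrow> N b \<noteq> 0" "\<And>b. b \<in> B \<Longrightarrow> of_int (N b) *\<^sub>R bs b \<in> L"
    "\<And>b. b \<in> B \<Longrightarrow> bs b \<in> L'"
    "\<And>x. x \<in> span L \<Longrightarrow> x = (\<Sum>b\<in>B. \<beta> x (bs b) *\<^sub>R b)"
    by (rule dual_basis) (rule that; assumption)
  have "x = (\<Sum>b\<in>B. \<beta> x (bs b) *\<^sub>R b)" using x B(6) by (simp add: dual_lattice_def)
  also have "\<dots> = (\<Sum>b\<in>B. of_int \<lfloor>\<beta> x (bs b)\<rfloor> *\<^sub>R b)"
    using int B(5) by (intro sum.cong) auto
  finally show ?thesis unfolding B(2) int_span_def by auto
qed

sublocale dual: comm_group G
proof (rule comm_groupI)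
  fix x assume "x \<in> carrier G"
  then show "\<exists>y\<in>carrier G. y \<otimes>\<^bsub>G\<^esub> x = \<one>\<^bsub>G\<^esub>"
    by (intro bexI[of _ "- x"]) (auto simp: dual_uminus)
qed (auto simp: dual_add dual_zero add_ac)

lemma inv_G: "x \<in> L' \<Longrightarrow> inv\<^bsub>G\<^esub> x = - x"
  by (rule dual.inv_equality) (auto simp: dual_uminus)

lemma normal_L: "L \<lhd> G"
proof (rule dual.normal_invI[OF dual.subgroupI])
  show "L \<subseteq> carrier G" using lattice_subset_dual by simp
  show "L \<noteq> {}" using lattice_zero by auto
  show "inv\<^bsub>G\<^esub> a \<in> L" if "a \<in> L" for a
    using that lattice_subset_dual by (auto simp: inv_G lattice_uminus)
  show "a \<otimes>\<^bsub>G\<^esub> b \<in> L" if "a \<in> L" "b \<in> L" for a b using that by (simp add: lattice_add)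
  show "x \<otimes>\<^bsub>G\<^esub> h \<otimes>\<^bsub>G\<^esub> inv\<^bsub>G\<^esub> x \<in> L" if "x \<in> carrier G" "h \<in> L" for x h
    using that by (simp add: inv_G)
qed

sublocale disc: comm_group D
  unfolding disc_group_def using normal_L
  by (intro dual.abelian_FactGroup) (auto simp: normal_def)

lemma mem_disc_iff: "\<xi> \<in> carrier D \<longleftrightarrow> (\<exists>x\<in>L'. \<xi> = {y. y - x \<in> L})"
proof -
  have "L #>\<^bsub>G\<^esub> x = {y. y - x \<in> L}" for x
    by (force simp: r_coset_def)
  then show ?thesis by (auto simp: disc_group_def carrier_FactGroup)
qed

lemma disc_rep:
  assumes "\<xi> \<in> carrier D"
  shows "(SOME x. x \<in> \<xi>) \<in> \<xi>" and "\<xi> \<subseteq> L'" and "x \<in> \<xi> \<Longrightarrow> y \<in> \<xi> \<Longrightarrow> x - y \<in> L"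
proof -
  obtain z where z: "z \<in> L'" "\<xi> = {y. y - z \<in> L}" using assms mem_disc_iff by auto
  then have "z \<in> \<xi>" using lattice_zero by simp
  then show "(SOME x. x \<in> \<xi>) \<in> \<xi>" by (rule someI)
  show "\<xi> \<subseteq> L'"
  proof
    fix y assume "y \<in> \<xi>"
    then have "y - z \<in> L'" using z lattice_subset_dual by auto
    then show "y \<in> L'" using dual_add[OF _ z(1)] by fastforce
  qed
  show "x - y \<in> L" if "x \<in> \<xi>" "y \<in> \<xi>"
    using lattice_diff[of "x - z" "y - z"] that z by simp
qed

lemma disc_mult_mem:
  assumes "\<xi> \<in> carrier D" "\<mu> \<in> carrier D" "x \<in> \<xi>" "y \<in> \<mu>"
  shows "x + y \<in> \<xi> \<otimes>\<^bsub>D\<^esub> \<mu>"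
  using assms by (auto simp: disc_group_def set_mult_def)

text \<open>Since \<open>N b * bs b\<close> lies in \<open>L\<close>, the coordinate of a dual
  vector at \<open>b\<close> is a fraction with denominator \<open>N b\<close>. Reducing the
  numerators modulo \<open>N b\<close> changes the vector by an element of \<open>L\<close>, so
  finitely many vectors of remainders represent all cosets.\<close>

lemma finite_disc: "finite (carrier D)"
proof -
  obtain B bs and N :: "'a \<Rightarrow> int" where B: "finite B" "L = int_span B"
    "\<And>b. b \<in> B \<Longrightarrow> N b \<noteq> 0" "\<And>b. b \<in> B \<Longrightarrow> of_int (N b) *\<^sub>R bs b \<in> L"
    "\<And>b. b \<in> B \<Longrightarrow> bs b \<in> L'"
    "\<And>x. x \<in> span L \<Longrightarrow> x = (\<Sum>b\<in>B. \<beta> x (bs b) *\<^sub>R b)"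
    by (rule dual_basis) (rule that; assumption)
  define R where "R = (\<lambda>r. {y. y - (\<Sum>b\<in>B. (of_int (r b) / of_int (N b)) *\<^sub>R b) \<in> L})"
  \<comment> \<open>The box is symmetric because \<open>N b\<close> may be negative, and
    \<open>mod\<close> takes the sign of the divisor.\<close>
  have "carrier D \<subseteq> R ` (\<Pi>\<^sub>E b\<in>B. {- \<bar>N b\<bar>..\<bar>N b\<bar>})"
  proof
    fix \<xi> assume "\<xi> \<in> carrier D"
    then obtain x where x: "x \<in> L'" "\<xi> = {y. y - x \<in> L}" using mem_disc_iff by auto
    define z where "z = (\<lambda>b. \<lfloor>of_int (N b) * \<beta> x (bs b)\<rfloor>)"
    have z: "of_int (z b) = of_int (N b) * \<beta> x (bs b)" if "b \<in> B" for b
      using dual_int_left[OF x(1) B(4)[OF that]] by (simp add: form_simps z_def)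
    define r where "r = (\<lambda>b\<in>B. z b mod N b)"
    let ?s = "\<Sum>b\<in>B. (of_int (r b) / of_int (N b)) *\<^sub>R b"
    have "x - ?s = (\<Sum>b\<in>B. of_int (z b div N b) *\<^sub>R b)"
    proof -
      have "x - ?s = (\<Sum>b\<in>B. (\<beta> x (bs b) - of_int (r b) / of_int (N b)) *\<^sub>R b)"
        using B(6)[of x] x(1) by (simp add: dual_lattice_def scaleR_left_diff_distrib sum_subtractf)
      also have "\<dots> = (\<Sum>b\<in>B. of_int (z b div N b) *\<^sub>R b)"
      proof (rule sum.cong)
        fix b assume b: "b \<in> B"
        have "of_int (z b) = (of_int (N b * (z b div N b) + z b mod N b) :: real)" by simp
        then have "\<beta> x (bs b) - of_int (r b) / of_int (N b) = of_int (z b div N b)"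
          using z[OF b] B(3)[OF b] b by (simp add: r_def field_simps del: mult_div_mod_eq) (simp add: of_int_mult[symmetric] of_int_add[symmetric] del: of_int_mult of_int_add)
        then show "(\<beta> x (bs b) - of_int (r b) / of_int (N b)) *\<^sub>R b = of_int (z b div N b) *\<^sub>R b"
          by simp
      qed simp
      finally show ?thesis .
    qed
    then have xs: "x - ?s \<in> L"
      unfolding B(2) int_span_def by (intro CollectI exI[of _ "\<lambda>b. z b div N b"] conjI TrueI)
    have "y - x \<in> L \<longleftrightarrow> y - ?s \<in> L" for y
      using lattice_add[OF _ xs, of "y - x"] lattice_diff[OF _ xs, of "y - ?s"] by auto
    then have "\<xi> = R r" unfolding x(2) R_def by simp
    moreover have "- \<bar>N b\<bar> \<le> z b mod N b \<and> z b mod N b \<le> \<bar>N b\<bar>" if "b \<in> B" for b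
      using abs_mod_less[OF B(3)[OF that], of "z b"] by auto
    then have "r \<in> (\<Pi>\<^sub>E b\<in>B. {- \<bar>N b\<bar>..\<bar>N b\<bar>})" by (auto simp: r_def)
    ultimately show "\<xi> \<in> R ` (\<Pi>\<^sub>E b\<in>B. {- \<bar>N b\<bar>..\<bar>N b\<bar>})" by auto
  qed
  then show ?thesis by (rule finite_subset) (use B(1) in \<open>auto intro!: finite_PiE\<close>)
qed

lemma disc_form_diff:
  assumes "\<xi> \<in> carrier D" "\<mu> \<in> carrier D" "x \<in> \<xi>" "y \<in> \<mu>"
  shows "disc_form \<beta> \<xi> \<mu> - \<beta> x y \<in> \<int>"
proof -
  let ?x = "SOME x. x \<in> \<xi>" and ?y = "SOME y. y \<in> \<mu>"
  have "disc_form \<beta> \<xi> \<mu> - \<beta> x y = \<beta> (?x - x) ?y + \<beta> x (?y - y)"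
    by (simp add: disc_form_def form_simps)
  moreover have "\<beta> (?x - x) ?y \<in> \<int>" "\<beta> x (?y - y) \<in> \<int>"
    using disc_rep[OF assms(1)] disc_rep[OF assms(2)] assms dual_int_left dual_int_right by blast+
  ultimately show ?thesis by simp
qed

section \<open>Orthogonality of the characters of \<open>L'/L\<close>\<close>

text \<open>Up to a scalar, the matrix of \<open>weil_S\<close>; in each argument it is a character
  of \<open>D\<close>.\<close>

definition disc_char :: "'a set \<Rightarrow> 'a set \<Rightarrow> complex" where
  "disc_char \<xi> \<mu> = e (- of_real (disc_form \<beta> \<xi> \<mu>))"

lemma disc_char_rep:
  assumes "\<xi> \<in> carrier D" "\<mu> \<in> carrier D" "x \<in> \<xi>" "y \<in> \<mu>"
  shows "disc_char \<xi> \<mu> = e (of_real (- \<beta> x y))"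
proof -
  have "- disc_form \<beta> \<xi> \<mu> - (- \<beta> x y) = - (disc_form \<beta> \<xi> \<mu> - \<beta> x y)" by simp
  also have "\<dots> \<in> \<int>" using disc_form_diff[OF assms] by (rule Ints_minus)
  finally show ?thesis using e_cong[of "- disc_form \<beta> \<xi> \<mu>" "- \<beta> x y"] by (simp add: disc_char_def)
qed

lemma disc_char_sym: "disc_char \<xi> \<mu> = disc_char \<mu> \<xi>"
  unfolding disc_char_def disc_form_def by (metis form_sym)

lemma disc_char_nonzero: "disc_char \<xi> \<mu> \<noteq> 0"
  by (simp add: disc_char_def e_def)

lemma cnj_disc_char: "cnj (disc_char \<xi> \<mu>) = inverse (disc_char \<xi> \<mu>)"
  by (simp add: disc_char_def e_def exp_cnj exp_minus)

lemma disc_char_mult: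
  assumes "\<xi> \<in> carrier D" "\<mu> \<in> carrier D" "\<nu> \<in> carrier D"
  shows "disc_char \<xi> (\<mu> \<otimes>\<^bsub>D\<^esub> \<nu>) = disc_char \<xi> \<mu> * disc_char \<xi> \<nu>"
proof -
  obtain x y z where "x \<in> \<xi>" "y \<in> \<mu>" "z \<in> \<nu>" using disc_rep(1) assms by blast
  then show ?thesis
    using disc_char_rep[of \<xi> "\<mu> \<otimes>\<^bsub>D\<^esub> \<nu>" x "y + z"] disc_char_rep[of \<xi> \<mu> x y] disc_char_rep[of \<xi> \<nu> x z]
      disc_mult_mem[of \<mu> \<nu> y z] assms
    by (simp add: form_simps e_add[symmetric])
qed

text \<open>If the two characters agree, the difference of representatives pairs integrally with the
  whole dual lattice, and \<open>dual_dual\<close> puts it into \<open>L\<close>.\<close>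

lemma disc_char_nondegenerate:
  assumes "\<xi> \<in> carrier D" "\<xi>' \<in> carrier D" "\<And>\<mu>. \<mu> \<in> carrier D \<Longrightarrow> disc_char \<xi> \<mu> = disc_char \<xi>' \<mu>"
  shows "\<xi> = \<xi>'"
proof -
  obtain x x' where x: "x \<in> \<xi>" "x' \<in> \<xi>'" using disc_rep(1) assms by blast
  have L': "x \<in> L'" "x' \<in> L'" using disc_rep(2) x assms by blast+
  then have xx: "x - x' \<in> L'" using dual_add[OF _ dual_uminus] by force
  have xx': "x - x' \<in> L"
  proof (rule dual_dual[OF xx])
    fix y assume y: "y \<in> L'"
    define \<mu> where "\<mu> = {z. z - y \<in> L}"
    have \<mu>: "\<mu> \<in> carrier D" "y \<in> \<mu>" using y lattice_zero mem_disc_iff by (auto simp: \<mu>_def)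
    have "e (of_real (- \<beta> x y)) = e (of_real (- \<beta> x' y))"
      using disc_char_rep[OF assms(1) \<mu>(1) x(1) \<mu>(2)] disc_char_rep[OF assms(2) \<mu>(1) x(2) \<mu>(2)] assms(3)[OF \<mu>(1)] by simp
    then have "e (of_real (\<beta> (x - x') y)) = 1"
      using e_add[of "of_real (\<beta> (x - x') y)" "of_real (- \<beta> x y)"]
      by (simp add: form_simps e_def)
    then show "\<beta> (x - x') y \<in> \<int>" by (simp only: e_eq_1_iff)
  qed
  obtain z z' where z: "\<xi> = {y. y - z \<in> L}" "\<xi>' = {y. y - z' \<in> L}"
    using assms(1,2) mem_disc_iff by auto
  have "(z' - x') + (x' - x) + (x - z) \<in> L"
    using x z xx' lattice_uminus[of "x' - z'"] lattice_uminus[of "x - x'"] by (intro lattice_add) auto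
  then have zz: "z' - z \<in> L" by simp
  have "y - z \<in> L \<longleftrightarrow> y - z' \<in> L" for y
    using lattice_add[OF _ zz, of "y - z'"] lattice_diff[OF _ zz, of "y - z"] by auto
  then show ?thesis unfolding z by simp
qed

text \<open>The product of one character with the conjugate of another is again a character, and by
  nondegeneracy it is nontrivial unless the two coincide.\<close>

lemma disc_char_orthogonality:
  assumes "\<xi> \<in> carrier D" "\<xi>' \<in> carrier D"
  shows "(\<Sum>\<mu>\<in>carrier D. disc_char \<xi> \<mu> * cnj (disc_char \<xi>' \<mu>)) = (if \<xi> = \<xi>' then of_nat (card (carrier D)) else 0)"
proof (cases "\<xi> = \<xi>'")
  case True
  then show ?thesis by (simp add: cnj_disc_char disc_char_nonzero)
next
  case False
  then obtain \<nu> where \<nu>: "\<nu> \<in> carrier D" "disc_char \<xi> \<nu> \<noteq> disc_char \<xi>' \<nu>"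
    using disc_char_nondegenerate[OF assms] by blast
  have "(\<Sum>\<mu>\<in>carrier D. disc_char \<xi> \<mu> * cnj (disc_char \<xi>' \<mu>)) = 0"
  proof (rule sum_character_eq_0[OF _ \<nu>(1)])
    show "disc_char \<xi> \<nu> * cnj (disc_char \<xi>' \<nu>) \<noteq> 1"
      using \<nu>(2) disc_char_nonzero[of \<xi>' \<nu>] by (auto simp: cnj_disc_char field_simps)
  qed (simp_all add: disc_char_mult assms \<nu> disc.is_group)
  then show ?thesis using False by simp
qed

end

section \<open>The metaplectic group\<close>

definition mat2 :: "real \<Rightarrow> real \<Rightarrow> real \<Rightarrow> real \<Rightarrow> real^2^2" where
  "mat2 a b c d = vector [vector [a, b], vector [c, d]]"

lemma mat2_nth [simp]:
  "mat2 a b c d $ 1 $ 1 = a" "mat2 a b c d $ 1 $ 2 = b"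
  "mat2 a b c d $ 2 $ 1 = c" "mat2 a b c d $ 2 $ 2 = d"
  by (simp_all add: mat2_def)

lemma mat2_eqI:
  fixes A B :: "real^2^2"
  shows "A $ 1 $ 1 = B $ 1 $ 1 \<Longrightarrow> A $ 1 $ 2 = B $ 1 $ 2 \<Longrightarrow> A $ 2 $ 1 = B $ 2 $ 1 \<Longrightarrow>
    A $ 2 $ 2 = B $ 2 $ 2 \<Longrightarrow> A = B"
  by (simp add: vec_eq_iff forall_2)

lemma mult_mat2_nth [simp]:
  fixes A B :: "real^2^2"
  shows "(A ** B) $ i $ j = A $ i $ 1 * B $ 1 $ j + A $ i $ 2 * B $ 2 $ j"
  by (simp add: matrix_matrix_mult_def sum_2)

lemma mat2_mult: "mat2 a b c d ** mat2 a' b' c' d' =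
    mat2 (a * a' + b * c') (a * b' + b * d') (c * a' + d * c') (c * b' + d * d')"
  by (rule mat2_eqI) simp_all

lemma det_mat2: "det (mat2 a b c d) = a * d - b * c"
  by (simp add: det_2)

lemma mat_1_mat2: "mat 1 = mat2 1 0 0 1"
  by (rule mat2_eqI) (simp_all add: mat_def)

lemma mat_1_nth [simp]: "(mat 1 :: real^2^2) $ 1 $ 1 = 1" "(mat 1 :: real^2^2) $ 1 $ 2 = 0"
  "(mat 1 :: real^2^2) $ 2 $ 1 = 0" "(mat 1 :: real^2^2) $ 2 $ 2 = 1"
  by (simp_all add: mat_def)

definition auto_factor :: "real^2^2 \<Rightarrow> complex \<Rightarrow> complex" where
  "auto_factor \<gamma> \<tau> = of_real (\<gamma>$2$1) * \<tau> + of_real (\<gamma>$2$2)"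

lemma auto_factor_nonzero:
  assumes "det \<gamma> > 0" "\<tau> \<in> upper_half"
  shows "auto_factor \<gamma> \<tau> \<noteq> 0"
proof
  assume a: "auto_factor \<gamma> \<tau> = 0"
  then have "Im (auto_factor \<gamma> \<tau>) = 0" "Re (auto_factor \<gamma> \<tau>) = 0" by simp_all
  then have "\<gamma>$2$1 = 0" "\<gamma>$2$2 = 0" using assms(2) by (auto simp: auto_factor_def upper_half_def)
  then show False using assms(1) by (simp add: det_2)
qed

lemma moebius_eq: "moebius \<gamma> \<tau> = (of_real (\<gamma>$1$1) * \<tau> + of_real (\<gamma>$1$2)) / auto_factor \<gamma> \<tau>"
  by (simp add: moebius_def auto_factor_def)

lemma Im_moebius: "Im (moebius \<gamma> \<tau>) = det \<gamma> * Im \<tau> / (cmod (auto_factor \<gamma> \<tau>))\<^sup>2"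
proof -
  have "Im (moebius \<gamma> \<tau>) = Im ((of_real (\<gamma>$1$1) * \<tau> + of_real (\<gamma>$1$2)) * cnj (auto_factor \<gamma> \<tau>))
      / (cmod (auto_factor \<gamma> \<tau>))\<^sup>2"
    by (simp add: moebius_eq complex_div_cnj[of _ "auto_factor \<gamma> \<tau>"])
  also have "Im ((of_real (\<gamma>$1$1) * \<tau> + of_real (\<gamma>$1$2)) * cnj (auto_factor \<gamma> \<tau>)) = det \<gamma> * Im \<tau>"
    by (simp add: auto_factor_def det_2 algebra_simps)
  finally show ?thesis .
qed

lemma moebius_upper_half: "det \<gamma> > 0 \<Longrightarrow> \<tau> \<in> upper_half \<Longrightarrow> moebius \<gamma> \<tau> \<in> upper_half"
  using auto_factor_nonzero[of \<gamma> \<tau>] by (simp add: upper_half_def Im_moebius)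

text \<open>The cocycle relation. It is the square of the product rule for second components and so
  makes \<open>GL2_cover\<close> closed under multiplication.\<close>

lemma auto_factor_mult:
  assumes "det \<gamma>' > 0" "\<tau> \<in> upper_half"
  shows "auto_factor (\<gamma> ** \<gamma>') \<tau> = auto_factor \<gamma> (moebius \<gamma>' \<tau>) * auto_factor \<gamma>' \<tau>"
  using auto_factor_nonzero[OF assms] unfolding moebius_eq
  by (simp add: auto_factor_def field_simps)

lemma moebius_mult:
  assumes "det \<gamma> > 0" "det \<gamma>' > 0" "\<tau> \<in> upper_half"
  shows "moebius (\<gamma> ** \<gamma>') \<tau> = moebius \<gamma> (moebius \<gamma>' \<tau>)"
proof -
  let ?N = "\<lambda>\<gamma> \<tau>. of_real (\<gamma>$1$1) * \<tau> + of_real ((\<gamma> :: real^2^2)$1$2) :: complex"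
  have nz: "auto_factor \<gamma>' \<tau> \<noteq> 0" using assms by (intro auto_factor_nonzero)
  have "?N (\<gamma> ** \<gamma>') \<tau> = ?N \<gamma> (moebius \<gamma>' \<tau>) * auto_factor \<gamma>' \<tau>"
    using nz unfolding moebius_eq by (simp add: auto_factor_def field_simps)
  then show ?thesis
    using nz auto_factor_mult[OF assms(2,3)] by (simp add: moebius_eq)
qed

lemma moebius_mat_1 [simp]: "moebius (mat 1) \<tau> = \<tau>"
  by (simp add: moebius_def)

lemma moebius_holomorphic: "det \<gamma> > 0 \<Longrightarrow> moebius \<gamma> holomorphic_on upper_half"
  unfolding moebius_def using auto_factor_nonzero
  by (intro holomorphic_intros) (auto simp: auto_factor_def)

section \<open>The group law of the cover and the subgroup \<open>Mp2Z\<close>\<close>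

lemma carrier_GL2_iff: "(\<gamma>, \<phi>) \<in> carrier GL2_cover \<longleftrightarrow>
    det \<gamma> > 0 \<and> \<phi> \<in> extensional upper_half \<and> \<phi> holomorphic_on upper_half \<and>
      (\<forall>\<tau>\<in>upper_half. (\<phi> \<tau>)\<^sup>2 = auto_factor \<gamma> \<tau>)"
  by (simp add: GL2_cover_def auto_factor_def)

lemma mult_GL2: "(\<gamma>, \<phi>) \<otimes>\<^bsub>GL2_cover\<^esub> (\<gamma>', \<phi>') = (\<gamma> ** \<gamma>', \<lambda>\<tau>\<in>upper_half. \<phi> (moebius \<gamma>' \<tau>) * \<phi>' \<tau>)"
  by (simp add: GL2_cover_def)

lemma one_GL2: "\<one>\<^bsub>GL2_cover\<^esub> = (mat 1, \<lambda>\<tau>\<in>upper_half. 1)"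
  by (simp add: GL2_cover_def)

lemma GL2_closed:
  assumes "(\<gamma>, \<phi>) \<in> carrier GL2_cover" "(\<gamma>', \<phi>') \<in> carrier GL2_cover"
  shows "(\<gamma> ** \<gamma>', \<lambda>\<tau>\<in>upper_half. \<phi> (moebius \<gamma>' \<tau>) * \<phi>' \<tau>) \<in> carrier GL2_cover"
proof -
  have d: "det \<gamma> > 0" "det \<gamma>' > 0" using assms by (auto simp: carrier_GL2_iff)
  have "(\<phi> \<circ> moebius \<gamma>') holomorphic_on upper_half"
    using assms moebius_upper_half[OF d(2)]
    by (intro holomorphic_on_compose_gen[OF moebius_holomorphic]) (auto simp: carrier_GL2_iff)
  then have "(\<lambda>\<tau>. \<phi> (moebius \<gamma>' \<tau>) * \<phi>' \<tau>) holomorphic_on upper_half"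
    using assms by (intro holomorphic_intros) (auto simp: carrier_GL2_iff o_def)
  then have "(\<lambda>\<tau>\<in>upper_half. \<phi> (moebius \<gamma>' \<tau>) * \<phi>' \<tau>) holomorphic_on upper_half"
    by (rule holomorphic_transform) simp
  then show ?thesis
    using assms d moebius_upper_half[OF d(2)]
    by (auto simp: carrier_GL2_iff det_mul power_mult_distrib auto_factor_mult)
qed

definition mat2_inv :: "real^2^2 \<Rightarrow> real^2^2" where
  "mat2_inv \<gamma> = mat2 (\<gamma>$2$2 / det \<gamma>) (- \<gamma>$1$2 / det \<gamma>) (- \<gamma>$2$1 / det \<gamma>) (\<gamma>$1$1 / det \<gamma>)"

lemma mat2_inv:
  assumes "det \<gamma> > 0"
  shows "mat2_inv \<gamma> ** \<gamma> = mat 1" "\<gamma> ** mat2_inv \<gamma> = mat 1" "det (mat2_inv \<gamma>) > 0"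
proof -
  have "\<gamma>$1$1 * \<gamma>$2$2 - \<gamma>$1$2 * \<gamma>$2$1 = det \<gamma>" by (simp add: det_2)
  then show 1: "mat2_inv \<gamma> ** \<gamma> = mat 1"
    using assms by (intro mat2_eqI) (simp_all add: mat2_inv_def field_simps)
  then have "det (mat2_inv \<gamma>) * det \<gamma> = 1" by (metis det_mul det_I)
  then show "det (mat2_inv \<gamma>) > 0" using assms by (metis zero_less_mult_pos2 zero_less_one)
  show "\<gamma> ** mat2_inv \<gamma> = mat 1" using 1 by (simp add: matrix_left_right_inverse)
qed

text \<open>The second component \<open>\<psi>\<close> of the inverse has to satisfy
  \<open>\<psi> (moebius \<gamma> \<tau>) * \<phi> \<tau> = 1\<close>; substituting the inverse
  transformation for the argument gives this formula.\<close>

definition cover_inv :: "mp \<Rightarrow> mp" where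
  "cover_inv = (\<lambda>(\<gamma>, \<phi>). (mat2_inv \<gamma>, \<lambda>\<tau>\<in>upper_half. 1 / \<phi> (moebius (mat2_inv \<gamma>) \<tau>)))"

lemma cover_inv_closed:
  assumes "(\<gamma>, \<phi>) \<in> carrier GL2_cover"
  shows "cover_inv (\<gamma>, \<phi>) \<in> carrier GL2_cover"
proof -
  have d: "det \<gamma> > 0" using assms by (simp add: carrier_GL2_iff)
  note d' = mat2_inv(3)[OF d]
  have sq: "(\<phi> \<tau>)\<^sup>2 = auto_factor \<gamma> \<tau>" if "\<tau> \<in> upper_half" for \<tau>
    using assms that by (simp add: carrier_GL2_iff)
  have nz: "\<phi> \<tau> \<noteq> 0" if "\<tau> \<in> upper_half" for \<tau>
    using sq[OF that] auto_factor_nonzero[OF d that] by auto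
  have "(\<phi> \<circ> moebius (mat2_inv \<gamma>)) holomorphic_on upper_half"
    using assms moebius_upper_half[OF d']
    by (intro holomorphic_on_compose_gen[OF moebius_holomorphic]) (auto simp: carrier_GL2_iff d')
  then have "(\<lambda>\<tau>. 1 / \<phi> (moebius (mat2_inv \<gamma>) \<tau>)) holomorphic_on upper_half"
    using nz moebius_upper_half[OF d'] by (intro holomorphic_intros) (auto simp: o_def)
  then have hol: "(\<lambda>\<tau>\<in>upper_half. 1 / \<phi> (moebius (mat2_inv \<gamma>) \<tau>)) holomorphic_on upper_half"
    by (rule holomorphic_transform) simp
  have "(1 / \<phi> (moebius (mat2_inv \<gamma>) \<tau>))\<^sup>2 = auto_factor (mat2_inv \<gamma>) \<tau>" if \<tau>: "\<tau> \<in> upper_half" for \<tau>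
  proof -
    have "auto_factor \<gamma> (moebius (mat2_inv \<gamma>) \<tau>) * auto_factor (mat2_inv \<gamma>) \<tau> = 1"
      using auto_factor_mult[OF d' \<tau>, of \<gamma>] mat2_inv(2)[OF d] by (simp add: auto_factor_def)
    then show ?thesis using sq moebius_upper_half[OF d' \<tau>] 
      by (simp add: power_divide) (metis div_by_1 mult.commute mult_zero_left nonzero_mult_div_cancel_right zero_neq_one divide_divide_eq_right nonzero_eq_divide_eq)
  qed
  then show ?thesis using hol d' by (simp add: cover_inv_def carrier_GL2_iff)
qed

lemma cover_inv_mult:
  assumes "(\<gamma>, \<phi>) \<in> carrier GL2_cover"
  shows "cover_inv (\<gamma>, \<phi>) \<otimes>\<^bsub>GL2_cover\<^esub> (\<gamma>, \<phi>) = \<one>\<^bsub>GL2_cover\<^esub>"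
proof -
  have d: "det \<gamma> > 0" using assms by (simp add: carrier_GL2_iff)
  have nz: "\<phi> \<tau> \<noteq> 0" if "\<tau> \<in> upper_half" for \<tau>
    using auto_factor_nonzero[OF d that] assms that by (force simp: carrier_GL2_iff)
  have "moebius (mat2_inv \<gamma>) (moebius \<gamma> \<tau>) = \<tau>" if "\<tau> \<in> upper_half" for \<tau>
    using moebius_mult[OF mat2_inv(3)[OF d] d that] mat2_inv(1)[OF d] by simp
  then show ?thesis
    using nz moebius_upper_half[OF d] mat2_inv(1)[OF d]
    by (auto simp: cover_inv_def mult_GL2 one_GL2 intro!: restrict_ext)
qed

interpretation GL2: group GL2_cover
proof (rule groupI)
  show "x \<otimes>\<^bsub>GL2_cover\<^esub> y \<in> carrier GL2_cover"
    if "x \<in> carrier GL2_cover" "y \<in> carrier GL2_cover" for x y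
    using that GL2_closed by (cases x; cases y) (simp add: mult_GL2)
  show "\<one>\<^bsub>GL2_cover\<^esub> \<in> carrier GL2_cover"
    by (auto simp: one_GL2 carrier_GL2_iff auto_factor_def intro: holomorphic_transform[of "\<lambda>_. 1"])
  show "x \<otimes>\<^bsub>GL2_cover\<^esub> y \<otimes>\<^bsub>GL2_cover\<^esub> z = x \<otimes>\<^bsub>GL2_cover\<^esub> (y \<otimes>\<^bsub>GL2_cover\<^esub> z)"
    if "x \<in> carrier GL2_cover" "y \<in> carrier GL2_cover" "z \<in> carrier GL2_cover" for x y z
  proof -
    obtain \<gamma> \<phi> \<gamma>' \<phi>' \<gamma>'' \<phi>'' where x: "x = (\<gamma>, \<phi>)" "y = (\<gamma>', \<phi>')" "z = (\<gamma>'', \<phi>'')"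
      by (cases x; cases y; cases z)
    have d: "det \<gamma>' > 0" "det \<gamma>'' > 0" using that x by (auto simp: carrier_GL2_iff)
    show ?thesis
      using moebius_mult[OF d] moebius_upper_half[OF d(2)]
      by (auto simp: x mult_GL2 matrix_mul_assoc intro!: restrict_ext)
  qed
  show "\<one>\<^bsub>GL2_cover\<^esub> \<otimes>\<^bsub>GL2_cover\<^esub> x = x" if "x \<in> carrier GL2_cover" for x
  proof -
    obtain \<gamma> \<phi> where x: "x = (\<gamma>, \<phi>)" by (cases x)
    have "moebius \<gamma> \<tau> \<in> upper_half" if "\<tau> \<in> upper_half" for \<tau>
      using \<open>x \<in> carrier GL2_cover\<close> moebius_upper_half that by (auto simp: x carrier_GL2_iff)
    \<comment> \<open>As \<open>\<phi>\<close> is extensional, restricting it to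
      \<open>upper_half\<close> changes nothing, and the identity law holds as an equality of
      functions.\<close>
    then show ?thesis
      using that by (auto simp: x mult_GL2 one_GL2 carrier_GL2_iff intro!: extensionalityI[of _ upper_half])
  qed
  show "\<exists>y\<in>carrier GL2_cover. y \<otimes>\<^bsub>GL2_cover\<^esub> x = \<one>\<^bsub>GL2_cover\<^esub>" if "x \<in> carrier GL2_cover" for x
    using that cover_inv_closed cover_inv_mult by (cases x) blast
qed

lemma inv_GL2: "(\<gamma>, \<phi>) \<in> carrier GL2_cover \<Longrightarrow> inv\<^bsub>GL2_cover\<^esub> (\<gamma>, \<phi>) = cover_inv (\<gamma>, \<phi>)"
  by (intro GL2.inv_equality cover_inv_mult cover_inv_closed)

lemma Mp2Z_iff: "(\<gamma>, \<phi>) \<in> Mp2Z \<longleftrightarrow> (\<gamma>, \<phi>) \<in> carrier GL2_cover \<and> det \<gamma> = 1 \<and> (\<forall>i j. \<gamma>$i$j \<in> \<int>)"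
  by (simp add: Mp2Z_def)

lemma subgroup_Mp2Z: "subgroup Mp2Z GL2_cover"
proof (rule GL2.subgroupI)
  show "Mp2Z \<subseteq> carrier GL2_cover" by (auto simp: Mp2Z_def)
  have "\<one>\<^bsub>GL2_cover\<^esub> \<in> Mp2Z"
    using GL2.one_closed unfolding one_GL2 by (auto simp: Mp2Z_iff forall_2)
  then show "Mp2Z \<noteq> {}" by auto
  show "inv\<^bsub>GL2_cover\<^esub> a \<in> Mp2Z" if a: "a \<in> Mp2Z" for a
  proof -
    obtain \<gamma> \<phi> where x: "a = (\<gamma>, \<phi>)" by (cases a)
    have c: "(\<gamma>, \<phi>) \<in> carrier GL2_cover" "det \<gamma> = 1" "\<forall>i j. \<gamma>$i$j \<in> \<int>"
      using a by (auto simp: x Mp2Z_iff)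
    have "det (mat2_inv \<gamma>) = 1" using c(2) by (simp add: mat2_inv_def det_2 algebra_simps)
    moreover have "\<forall>i j. mat2_inv \<gamma>$i$j \<in> \<int>" using c(2,3) by (simp add: forall_2 mat2_inv_def)
    ultimately show ?thesis using cover_inv_closed[OF c(1)] inv_GL2[OF c(1)]
      by (simp add: x cover_inv_def Mp2Z_iff)
  qed
  show "a \<otimes>\<^bsub>GL2_cover\<^esub> b \<in> Mp2Z" if ab: "a \<in> Mp2Z" "b \<in> Mp2Z" for a b
  proof -
    obtain \<gamma> \<phi> \<gamma>' \<phi>' where x: "a = (\<gamma>, \<phi>)" "b = (\<gamma>', \<phi>')" by (cases a; cases b)
    show ?thesis using ab GL2_closed[of \<gamma> \<phi> \<gamma>' \<phi>'] unfolding x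
      by (auto simp: mult_GL2 Mp2Z_iff det_mul)
  qed
qed

interpretation Mp2Z: subgroup Mp2Z GL2_cover by (rule subgroup_Mp2Z)

lemma g_sq_carrier: "m > 0 \<Longrightarrow> g_sq m \<in> carrier GL2_cover"
  by (auto simp: g_sq_def carrier_GL2_iff auto_factor_def det_2 intro: holomorphic_transform[of "\<lambda>_. 1"])

section \<open>Hermite normal form and generators of the metaplectic group\<close>

lemma fst_mult_GL2 [simp]: "fst (x \<otimes>\<^bsub>GL2_cover\<^esub> y) = fst x ** fst y"
  by (cases x; cases y) (simp add: mult_GL2)

lemma T_bar_mat2: "T_bar = (mat2 1 1 0 1, \<lambda>\<tau>\<in>upper_half. 1)"
  and S_bar_mat2: "S_bar = (mat2 0 (- 1) 1 0, \<lambda>\<tau>\<in>upper_half. csqrt \<tau>)"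
  and g_sq_mat2: "g_sq m = (mat2 (real (m^2)) 0 0 1, \<lambda>\<tau>\<in>upper_half. 1)"
  by (simp_all add: T_bar_def S_bar_def g_sq_def mat2_def)

lemma T_bar_Mp2Z: "T_bar \<in> Mp2Z"
  by (auto simp: T_bar_mat2 Mp2Z_iff carrier_GL2_iff auto_factor_def det_2 forall_2
      intro: holomorphic_transform[of "\<lambda>_. 1"])

lemma S_bar_Mp2Z: "S_bar \<in> Mp2Z"
proof -
  have "csqrt holomorphic_on upper_half"
    by (rule holomorphic_on_subset[OF holomorphic_on_csqrt])
      (auto simp: upper_half_def complex_nonpos_Reals_iff)
  then have "(\<lambda>\<tau>\<in>upper_half. csqrt \<tau>) holomorphic_on upper_half"
    by (rule holomorphic_transform) simp
  then show ?thesis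
    by (auto simp: S_bar_mat2 Mp2Z_iff carrier_GL2_iff auto_factor_def det_2 forall_2)
qed

text \<open>A continuous square root of 1 on a connected set is constant, so exactly two signs are
  possible over the identity matrix.\<close>

lemma cover_kernel:
  assumes "(mat 1, \<phi>) \<in> carrier GL2_cover"
  shows "\<phi> = (\<lambda>\<tau>\<in>upper_half. 1) \<or> \<phi> = (\<lambda>\<tau>\<in>upper_half. - 1)"
proof -
  have sq: "(\<phi> \<tau>)\<^sup>2 = 1" if "\<tau> \<in> upper_half" for \<tau>
    using assms that by (simp add: carrier_GL2_iff auto_factor_def)
  have "connected upper_half" unfolding upper_half_def by (intro convex_connected convex_halfspace_Im_gt)
  moreover have "continuous_on upper_half \<phi>"
    using assms by (auto simp: carrier_GL2_iff intro: holomorphic_on_imp_continuous_on)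
  moreover have "finite (\<phi> ` upper_half)"
    by (rule finite_subset[of _ "{1, - 1}"]) (use sq in \<open>auto simp: power2_eq_1_iff\<close>)
  ultimately have "\<phi> constant_on upper_half" by (rule continuous_finite_range_constant)
  then obtain c where c: "\<And>\<tau>. \<tau> \<in> upper_half \<Longrightarrow> \<phi> \<tau> = c" by (auto simp: constant_on_def)
  have "\<i> \<in> upper_half" by (simp add: upper_half_def)
  then have "c = 1 \<or> c = -1" using sq c by (metis power2_eq_1_iff)
  moreover have "\<phi> = (\<lambda>\<tau>\<in>upper_half. c)"
    using assms c by (intro extensionalityI[of _ upper_half]) (auto simp: carrier_GL2_iff)
  ultimately show ?thesis by auto
qed

lemma subgroup_T_powers:
  assumes K: "subgroup K GL2_cover" and T: "T_bar \<in> K"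
  shows "\<exists>t\<in>K. fst t = mat2 1 (of_int n) 0 1"
proof -
  interpret K: subgroup K GL2_cover by fact
  have inv: "fst (inv\<^bsub>GL2_cover\<^esub> t) = mat2 1 (- x) 0 1" if "t \<in> K" "fst t = mat2 1 x 0 1" for t x
    using that K.mem_carrier[OF that(1)]
    by (cases t) (auto simp: inv_GL2 cover_inv_def mat2_inv_def det_2)
  have nat: "\<exists>t\<in>K. fst t = mat2 1 (real n) 0 1" for n
  proof (induction n)
    case 0
    show ?case using K.one_closed
      by (intro bexI[of _ "\<one>\<^bsub>GL2_cover\<^esub>"]) (auto simp: one_GL2 mat_1_mat2)
  next
    case (Suc n)
    then obtain t where "t \<in> K" "fst t = mat2 1 (real n) 0 1" by auto
    then show ?case using T
      by (intro bexI[of _ "t \<otimes>\<^bsub>GL2_cover\<^esub> T_bar"]) (auto simp: T_bar_mat2 mat2_mult)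
  qed
  show ?thesis
  proof (cases n)
    case (nonneg k) then show ?thesis using nat[of k] by simp
  next
    case (neg k)
    obtain t where t: "t \<in> K" "fst t = mat2 1 (real (Suc k)) 0 1" using nat by blast
    show ?thesis using inv[OF t] t(1) neg by (intro bexI[of _ "inv\<^bsub>GL2_cover\<^esub> t"]) auto
  qed
qed

text \<open>Euclid's algorithm on the first column: a power of \<open>T_bar\<close> replaces
  \<open>a\<close> by \<open>a mod c\<close>, then \<open>S_bar\<close> exchanges the two entries up
  to sign, so the absolute value of the lower left entry drops.\<close>

lemma triangularize:
  fixes a b c d :: int
  assumes K: "subgroup K GL2_cover" "T_bar \<in> K" "S_bar \<in> K"
    and "x \<in> carrier GL2_cover" "fst x = mat2 (of_int a) (of_int b) (of_int c) (of_int d)"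
  shows "\<exists>\<kappa>\<in>K. \<exists>a b d :: int. fst (\<kappa> \<otimes>\<^bsub>GL2_cover\<^esub> x) = mat2 (of_int a) (of_int b) 0 (of_int d)"
  using assms(4,5)
proof (induction "nat \<bar>c\<bar>" arbitrary: x a b c d rule: less_induct)
  case less
  interpret K: subgroup K GL2_cover by fact
  show ?case
  proof (cases "c = 0")
    case True
    then show ?thesis using less.prems
      by (intro bexI[of _ "\<one>\<^bsub>GL2_cover\<^esub>"] exI[of _ a] exI[of _ b] exI[of _ d]) auto
  next
    case False
    define q where "q = a div c"
    obtain t where t: "t \<in> K" "fst t = mat2 1 (of_int (- q)) 0 1"
      using subgroup_T_powers[OF K(1,2)] by blast
    let ?s = "S_bar \<otimes>\<^bsub>GL2_cover\<^esub> t"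
    have s: "?s \<in> K" using t K by blast
    have "a - q * c = a mod c" by (simp add: q_def minus_div_mult_eq_mod)
    then have lt: "nat \<bar>a - q * c\<bar> < nat \<bar>c\<bar>" using abs_mod_less[OF False, of a] by simp
    have "fst (?s \<otimes>\<^bsub>GL2_cover\<^esub> x) = mat2 (of_int (- c)) (of_int (- d)) (of_int (a - q * c)) (of_int (b - q * d))"
      by (simp add: S_bar_mat2 t(2) less.prems mat2_mult)
    moreover have "?s \<otimes>\<^bsub>GL2_cover\<^esub> x \<in> carrier GL2_cover"
      using K.mem_carrier[OF s] less.prems(1) by (rule GL2.m_closed)
    ultimately obtain \<kappa> a' b' d' where \<kappa>: "\<kappa> \<in> K"
      "fst (\<kappa> \<otimes>\<^bsub>GL2_cover\<^esub> (?s \<otimes>\<^bsub>GL2_cover\<^esub> x)) = mat2 (of_int a') (of_int b') 0 (of_int (d' :: int))"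
      using less.hyps[OF lt, of "?s \<otimes>\<^bsub>GL2_cover\<^esub> x"] by blast
    have "\<kappa> \<otimes>\<^bsub>GL2_cover\<^esub> (?s \<otimes>\<^bsub>GL2_cover\<^esub> x) = \<kappa> \<otimes>\<^bsub>GL2_cover\<^esub> ?s \<otimes>\<^bsub>GL2_cover\<^esub> x"
      using \<kappa>(1) s less.prems(1) by (intro GL2.m_assoc[symmetric]) auto
    moreover have "\<kappa> \<otimes>\<^bsub>GL2_cover\<^esub> ?s \<in> K" using \<kappa>(1) s by blast
    ultimately show ?thesis using \<kappa>(2) by metis
  qed
qed

text \<open>The subgroup \<open>K\<close> is arbitrary because the lemma has two uses: with
  \<open>Mp2Z\<close> itself it reduces Hecke cosets, and with an intersection inside
  \<open>Mp2Z\<close> it shows that \<open>T_bar\<close> and \<open>S_bar\<close> generate. Only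
  matrices are tracked; the second components are settled where they matter.\<close>

lemma hermite_form:
  assumes K: "subgroup K GL2_cover" "T_bar \<in> K" "S_bar \<in> K"
    and x: "x \<in> carrier GL2_cover" and int: "\<forall>i j. fst x $ i $ j \<in> \<int>"
  obtains \<kappa> and a b d :: int where "\<kappa> \<in> K" "0 < a" "0 \<le> b" "b < d"
    "fst (\<kappa> \<otimes>\<^bsub>GL2_cover\<^esub> x) = mat2 (of_int a) (of_int b) 0 (of_int d)"
proof -
  interpret K: subgroup K GL2_cover by fact
  have carrier_det: "det (fst y) > 0" if "y \<in> carrier GL2_cover" for y
    using that by (cases y) (simp add: carrier_GL2_iff)
  have "fst x = mat2 (of_int \<lfloor>fst x$1$1\<rfloor>) (of_int \<lfloor>fst x$1$2\<rfloor>) (of_int \<lfloor>fst x$2$1\<rfloor>) (of_int \<lfloor>fst x$2$2\<rfloor>)"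
    using int by (intro mat2_eqI) simp_all
  then obtain \<kappa> and a b d :: int where \<kappa>: "\<kappa> \<in> K" "fst (\<kappa> \<otimes>\<^bsub>GL2_cover\<^esub> x) = mat2 (of_int a) (of_int b) 0 (of_int d)"
    using triangularize[OF K x] by blast
  have kx: "\<kappa> \<otimes>\<^bsub>GL2_cover\<^esub> x \<in> carrier GL2_cover"
    using K.mem_carrier[OF \<kappa>(1)] x by (rule GL2.m_closed)
  have "real_of_int (a * d) > 0" using carrier_det[OF kx] unfolding \<kappa>(2) by (simp add: det_mat2)
  then have ad: "a * d > 0" by linarith
  have "\<exists>\<kappa>\<in>K. \<exists>a b d :: int. 0 < a \<and> 0 < d \<and> fst (\<kappa> \<otimes>\<^bsub>GL2_cover\<^esub> x) = mat2 (of_int a) (of_int b) 0 (of_int d)"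
  proof (cases "a > 0")
    case True
    then have "d > 0" using ad by (simp add: zero_less_mult_iff)
    then show ?thesis using \<kappa> True by blast
  next
    case False
    \<comment> \<open>\<open>S_bar\<close> squared lies over minus the identity, so this flips the
      signs of all entries.\<close>
    let ?k = "S_bar \<otimes>\<^bsub>GL2_cover\<^esub> (S_bar \<otimes>\<^bsub>GL2_cover\<^esub> \<kappa>)"
    have "fst (?k \<otimes>\<^bsub>GL2_cover\<^esub> x) = fst S_bar ** (fst S_bar ** (fst (\<kappa> \<otimes>\<^bsub>GL2_cover\<^esub> x)))"
      by (simp add: matrix_mul_assoc)
    also have "\<dots> = mat2 (of_int (- a)) (of_int (- b)) 0 (of_int (- d))"
      unfolding \<kappa>(2) by (simp add: S_bar_mat2 mat2_mult)
    finally have eq: "fst (?k \<otimes>\<^bsub>GL2_cover\<^esub> x) = mat2 (of_int (- a)) (of_int (- b)) 0 (of_int (- d))" .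
    have "0 < - a" "0 < - d" using False ad by (auto simp: zero_less_mult_iff)
    moreover have "?k \<in> K" using \<kappa>(1) K by blast
    ultimately show ?thesis using eq by blast
  qed
  then obtain \<kappa> and a b d :: int where \<kappa>: "\<kappa> \<in> K" "0 < a" "0 < d"
    "fst (\<kappa> \<otimes>\<^bsub>GL2_cover\<^esub> x) = mat2 (of_int a) (of_int b) 0 (of_int d)" by blast
  \<comment> \<open>Left multiplication by this unipotent matrix subtracts a multiple of the second
    row and so reduces \<open>b\<close> modulo \<open>d\<close>.\<close>
  obtain t where t: "t \<in> K" "fst t = mat2 1 (of_int (- (b div d))) 0 1"
    using subgroup_T_powers[OF K(1,2)] by blast
  have "fst (t \<otimes>\<^bsub>GL2_cover\<^esub> \<kappa> \<otimes>\<^bsub>GL2_cover\<^esub> x) = fst t ** fst (\<kappa> \<otimes>\<^bsub>GL2_cover\<^esub> x)"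
    by (simp add: matrix_mul_assoc)
  also have "\<dots> = mat2 (of_int a) (of_int (b - b div d * d)) 0 (of_int d)"
    unfolding t(2) \<kappa>(4) by (simp add: mat2_mult)
  also have "b - b div d * d = b mod d" by (simp add: minus_div_mult_eq_mod)
  finally show thesis
    using t(1) \<kappa> by (intro that[of "t \<otimes>\<^bsub>GL2_cover\<^esub> \<kappa>" a "b mod d" d]) auto
qed

text \<open>The Hermite form of a matrix of determinant 1 is the identity. Every element of
  \<open>Mp2Z\<close> is thus carried by \<open>K\<close> into the kernel of the projection to
  matrices, and both kernel elements lie in \<open>K\<close>.\<close>

lemma Mp2Z_generated:
  assumes K: "subgroup K GL2_cover" "T_bar \<in> K" "S_bar \<in> K"
  shows "Mp2Z \<subseteq> K"
proof
  interpret K: subgroup K GL2_cover by fact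
  \<comment> \<open>the nontrivial element of the kernel to \<open>SL2\<close> is \<open>S_bar\<close> to the fourth power\<close>
  have m1: "(mat 1, \<lambda>\<tau>\<in>upper_half. - 1) \<in> K"
  proof -
    define s where "s = S_bar \<otimes>\<^bsub>GL2_cover\<^esub> S_bar"
    obtain \<gamma> \<phi> where s: "s = (\<gamma>, \<phi>)" by (cases s)
    have sK: "s \<in> K" using K by (simp add: s_def)
    have "\<gamma> = fst s" by (simp add: s)
    then have \<gamma>: "\<gamma> = mat2 (-1) 0 0 (-1)" by (simp add: s_def S_bar_mat2 mat2_mult)
    \<comment> \<open>Which root \<open>\<phi>\<close> is does not have to be computed:
      \<open>s\<close> lies over minus the identity, whose automorphy factor is -1 and which fixes
      every point.\<close>
    have sq: "\<phi> \<tau> * \<phi> \<tau> = - 1" if "\<tau> \<in> upper_half" for \<tau>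
      using K.mem_carrier[OF sK] that by (auto simp: s carrier_GL2_iff \<gamma> auto_factor_def power2_eq_square)
    have "s \<otimes>\<^bsub>GL2_cover\<^esub> s = (mat 1, \<lambda>\<tau>\<in>upper_half. - 1)"
      unfolding s mult_GL2 using sq
      by (auto simp: \<gamma> mat2_mult mat_1_mat2 moebius_def intro!: restrict_ext)
    then show ?thesis using K.m_closed[OF sK sK] by simp
  qed
  fix x assume x: "x \<in> Mp2Z"
  have xc: "x \<in> carrier GL2_cover" "\<forall>i j. fst x $ i $ j \<in> \<int>"
    using x by (cases x; simp add: Mp2Z_iff)+
  \<comment> \<open>Reducing inside \<open>Mp2Z\<close> keeps the determinant equal to 1, which
    forces the diagonal of the Hermite form.\<close>
  have KM: "subgroup (K \<inter> Mp2Z) GL2_cover" using K(1) subgroup_Mp2Z by (rule GL2.subgroups_Inter_pair)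
  obtain \<kappa> and a b d :: int where \<kappa>: "\<kappa> \<in> K \<inter> Mp2Z" "0 < a" "0 \<le> b" "b < d"
    "fst (\<kappa> \<otimes>\<^bsub>GL2_cover\<^esub> x) = mat2 (of_int a) (of_int b) 0 (of_int d)"
    using hermite_form[OF KM _ _ xc] K T_bar_Mp2Z S_bar_Mp2Z by blast
  have kc: "\<kappa> \<in> carrier GL2_cover" using \<kappa>(1) by (auto intro: K.mem_carrier)
  have "\<kappa> \<otimes>\<^bsub>GL2_cover\<^esub> x \<in> Mp2Z" using \<kappa>(1) x by auto
  then have "det (fst (\<kappa> \<otimes>\<^bsub>GL2_cover\<^esub> x)) = 1"
    by (cases "\<kappa> \<otimes>\<^bsub>GL2_cover\<^esub> x") (simp add: Mp2Z_iff)
  then have "real_of_int (a * d) = 1" unfolding \<kappa>(5) by (simp add: det_mat2)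
  then have "a * d = 1" by linarith
  then have "a = 1" "d = 1" using \<kappa>(2) by (auto simp: zmult_eq_1_iff)
  moreover from this have "b = 0" using \<kappa>(3,4) by simp
  ultimately have k1: "fst (\<kappa> \<otimes>\<^bsub>GL2_cover\<^esub> x) = mat 1" using \<kappa>(5) by (simp add: mat_1_mat2)
  have kx: "\<kappa> \<otimes>\<^bsub>GL2_cover\<^esub> x \<in> carrier GL2_cover" using kc xc by blast
  have "\<kappa> \<otimes>\<^bsub>GL2_cover\<^esub> x = (mat 1, \<lambda>\<tau>\<in>upper_half. 1) \<or> \<kappa> \<otimes>\<^bsub>GL2_cover\<^esub> x = (mat 1, \<lambda>\<tau>\<in>upper_half. - 1)"
    using cover_kernel[of "snd (\<kappa> \<otimes>\<^bsub>GL2_cover\<^esub> x)"] k1 kx by (metis prod.collapse)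
  then have "\<kappa> \<otimes>\<^bsub>GL2_cover\<^esub> x \<in> K" using m1 K.one_closed by (auto simp: one_GL2)
  then have "inv\<^bsub>GL2_cover\<^esub> \<kappa> \<otimes>\<^bsub>GL2_cover\<^esub> (\<kappa> \<otimes>\<^bsub>GL2_cover\<^esub> x) \<in> K" using \<kappa>(1) by blast
  then show "x \<in> K" using kc xc(1) by (simp add: GL2.m_assoc[symmetric])
qed

lemma coset_mult_Mp2Z:
  assumes "\<kappa> \<in> Mp2Z" "x \<in> carrier GL2_cover"
  shows "Mp2Z #>\<^bsub>GL2_cover\<^esub> (\<kappa> \<otimes>\<^bsub>GL2_cover\<^esub> x) = Mp2Z #>\<^bsub>GL2_cover\<^esub> x"
proof -
  have "Mp2Z #>\<^bsub>GL2_cover\<^esub> (\<kappa> \<otimes>\<^bsub>GL2_cover\<^esub> x) = (Mp2Z #>\<^bsub>GL2_cover\<^esub> \<kappa>) #>\<^bsub>GL2_cover\<^esub> x"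
    using assms by (intro GL2.coset_mult_assoc[symmetric]) (auto simp: Mp2Z.subset)
  also have "Mp2Z #>\<^bsub>GL2_cover\<^esub> \<kappa> = Mp2Z"
    using assms by (intro GL2.coset_join2 subgroup_Mp2Z) auto
  finally show ?thesis .
qed

text \<open>Two lifts of the same matrix differ by an element over the identity, and such elements
  belong to \<open>Mp2Z\<close>. Hence a coset can be described by a matrix alone.\<close>

lemma coset_eqI:
  assumes x: "x \<in> carrier GL2_cover" "y \<in> carrier GL2_cover" and eq: "fst x = fst y"
  shows "Mp2Z #>\<^bsub>GL2_cover\<^esub> x = Mp2Z #>\<^bsub>GL2_cover\<^esub> y"
proof -
  let ?z = "y \<otimes>\<^bsub>GL2_cover\<^esub> inv\<^bsub>GL2_cover\<^esub> x"
  have d: "det (fst y) > 0" using x(2) by (cases y) (simp add: carrier_GL2_iff)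
  have "fst ?z = mat 1" using x eq mat2_inv(2)[OF d]
    by (cases x) (simp add: inv_GL2 cover_inv_def)
  moreover have "?z \<in> carrier GL2_cover" using x by blast
  ultimately have "?z \<in> Mp2Z" by (cases ?z) (auto simp: Mp2Z_iff forall_2)
  then have "Mp2Z #>\<^bsub>GL2_cover\<^esub> (?z \<otimes>\<^bsub>GL2_cover\<^esub> x) = Mp2Z #>\<^bsub>GL2_cover\<^esub> x"
    using x by (intro coset_mult_Mp2Z)
  moreover have "?z \<otimes>\<^bsub>GL2_cover\<^esub> x = y" using x by (simp add: GL2.m_assoc)
  ultimately show ?thesis by simp
qed

section \<open>Hecke cosets\<close>

lemma double_coset_mult_left:
  assumes "\<kappa> \<in> Mp2Z" "\<delta> \<in> double_coset m" "m > 0"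
  shows "\<kappa> \<otimes>\<^bsub>GL2_cover\<^esub> \<delta> \<in> double_coset m"
proof -
  obtain \<gamma> \<gamma>' where g: "\<gamma> \<in> Mp2Z" "\<gamma>' \<in> Mp2Z" "\<delta> = \<gamma> \<otimes>\<^bsub>GL2_cover\<^esub> g_sq m \<otimes>\<^bsub>GL2_cover\<^esub> \<gamma>'"
    using assms(2) by (auto simp: double_coset_def)
  have "\<kappa> \<otimes>\<^bsub>GL2_cover\<^esub> \<delta> = (\<kappa> \<otimes>\<^bsub>GL2_cover\<^esub> \<gamma>) \<otimes>\<^bsub>GL2_cover\<^esub> g_sq m \<otimes>\<^bsub>GL2_cover\<^esub> \<gamma>'"
    using g assms(1) g_sq_carrier[OF assms(3)] by (simp add: GL2.m_assoc)
  then show ?thesis unfolding double_coset_def using g assms(1) Mp2Z.m_closed by blast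
qed

lemma double_coset_carrier: "m > 0 \<Longrightarrow> \<delta> \<in> double_coset m \<Longrightarrow> \<delta> \<in> carrier GL2_cover"
  using g_sq_carrier[of m] by (auto simp: double_coset_def)

lemma g_sq_double_coset: "m > 0 \<Longrightarrow> g_sq m \<in> double_coset m"
  unfolding double_coset_def using g_sq_carrier[of m] Mp2Z.one_closed
  by (intro CollectI exI[of _ "\<one>\<^bsub>GL2_cover\<^esub>"]) simp

lemma hecke_coset_rep:
  assumes "m > 0" "C \<in> hecke_cosets m"
  shows "(SOME \<delta>. \<delta> \<in> C) \<in> C" "C \<subseteq> double_coset m"
proof -
  obtain \<delta> where \<delta>: "\<delta> \<in> double_coset m" "C = Mp2Z #>\<^bsub>GL2_cover\<^esub> \<delta>"
    using assms(2) by (auto simp: hecke_cosets_def)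
  have "\<delta> \<in> C" unfolding \<delta>(2) using double_coset_carrier[OF assms(1) \<delta>(1)]
    by (intro GL2.rcos_self subgroup_Mp2Z)
  then show "(SOME \<delta>. \<delta> \<in> C) \<in> C" by (rule someI)
  show "C \<subseteq> double_coset m"
    using double_coset_mult_left[OF _ \<delta>(1) assms(1)] by (auto simp: \<delta>(2) r_coset_def)
qed

text \<open>Pitfall: every matrix satisfies \<open>int_multiple 0\<close>, as \<open>x / 0 = 0\<close>.\<close>

definition int_multiple :: "int \<Rightarrow> real^2^2 \<Rightarrow> bool" where
  "int_multiple p M \<longleftrightarrow> (\<forall>i j. M $ i $ j / of_int p \<in> \<int>)"

lemma int_multiple_mult:
  assumes "int_multiple p M" "int_multiple q N"
  shows "int_multiple (p * q) (M ** N)"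
proof -
  have "(M ** N) $ i $ j / of_int (p * q) = M$i$1 / of_int p * (N$1$j / of_int q) + M$i$2 / of_int p * (N$2$j / of_int q)"
    for i j by (simp add: add_divide_distrib)
  moreover have "M$i$l / of_int p * (N$l$j / of_int q) \<in> \<int>" for i j l
    using assms unfolding int_multiple_def by (blast intro: Ints_mult)
  ultimately show ?thesis unfolding int_multiple_def by (metis Ints_add)
qed

lemma Mp2Z_int_multiple: "\<gamma> \<in> Mp2Z \<Longrightarrow> int_multiple 1 (fst \<gamma>)"
  by (cases \<gamma>) (auto simp: int_multiple_def Mp2Z_iff)

section \<open>Primitivity and the number of Hecke cosets\<close>

text \<open>For the last claim, the outer factors and their inverses are integral, so a common
  divisor of the entries of \<open>\<delta>\<close> also divides all entries of
  \<open>g_sq m\<close>, one of which is 1.\<close>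

lemma double_coset_integral:
  assumes "m > 0" "\<delta> \<in> double_coset m"
  shows "int_multiple 1 (fst \<delta>)" "det (fst \<delta>) = (real m)\<^sup>2" "p \<noteq> 0 \<Longrightarrow> int_multiple p (fst \<delta>) \<Longrightarrow> \<bar>p\<bar> = 1"
proof -
  obtain \<gamma> \<gamma>' where g: "\<gamma> \<in> Mp2Z" "\<gamma>' \<in> Mp2Z" "\<delta> = \<gamma> \<otimes>\<^bsub>GL2_cover\<^esub> g_sq m \<otimes>\<^bsub>GL2_cover\<^esub> \<gamma>'"
    using assms(2) by (auto simp: double_coset_def)
  have "int_multiple 1 (fst (g_sq m))" by (auto simp: g_sq_mat2 int_multiple_def forall_2)
  then show "int_multiple 1 (fst \<delta>)"
    using int_multiple_mult[of 1 "fst \<gamma> ** fst (g_sq m)" 1 "fst \<gamma>'"] int_multiple_mult[of 1 "fst \<gamma>" 1 "fst (g_sq m)"]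
      Mp2Z_int_multiple g by simp
  have "det (fst \<gamma>) = 1" "det (fst \<gamma>') = 1" using g(1,2) by (cases \<gamma>; cases \<gamma>'; simp add: Mp2Z_iff)+
  then show "det (fst \<delta>) = (real m)\<^sup>2" by (simp add: g(3) det_mul g_sq_mat2 det_mat2)
  show "\<bar>p\<bar> = 1" if "p \<noteq> 0" and p: "int_multiple p (fst \<delta>)"
  proof -
    have "g_sq m = inv\<^bsub>GL2_cover\<^esub> \<gamma> \<otimes>\<^bsub>GL2_cover\<^esub> \<delta> \<otimes>\<^bsub>GL2_cover\<^esub> inv\<^bsub>GL2_cover\<^esub> \<gamma>'"
    proof -
      have c: "\<gamma> \<in> carrier GL2_cover" "\<gamma>' \<in> carrier GL2_cover" "g_sq m \<in> carrier GL2_cover"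
        using g(1,2) g_sq_carrier[OF assms(1)] by auto
      then have "g_sq m \<otimes>\<^bsub>GL2_cover\<^esub> \<gamma>' = inv\<^bsub>GL2_cover\<^esub> \<gamma> \<otimes>\<^bsub>GL2_cover\<^esub> \<delta>"
        by (subst GL2.inv_solve_left) (auto simp: g(3) GL2.m_assoc)
      moreover have "\<delta> \<in> carrier GL2_cover" using c by (simp add: g(3))
      ultimately show ?thesis using c by (subst GL2.inv_solve_right) auto
    qed
    moreover have "int_multiple (1 * p * 1) (fst (inv\<^bsub>GL2_cover\<^esub> \<gamma> \<otimes>\<^bsub>GL2_cover\<^esub> \<delta> \<otimes>\<^bsub>GL2_cover\<^esub> inv\<^bsub>GL2_cover\<^esub> \<gamma>'))"
      unfolding fst_mult_GL2 using p g(1,2) by (intro int_multiple_mult Mp2Z_int_multiple) auto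
    ultimately have "int_multiple p (fst (g_sq m))" by simp
    then have "1 / real_of_int p \<in> \<int>" by (auto simp: int_multiple_def g_sq_mat2 forall_2)
    then obtain q :: int where q: "1 / real_of_int p = of_int q" by (auto elim: Ints_cases)
    have "real_of_int (p * q) = 1" using q \<open>p \<noteq> 0\<close> by (simp add: field_simps)
    then have "p * q = 1" by linarith
    then show ?thesis by (auto simp: zmult_eq_1_iff)
  qed
qed

definition hermite_triples :: "nat \<Rightarrow> (int \<times> int \<times> int) set" where
  "hermite_triples m = {(a, b, d). 0 < a \<and> 0 \<le> b \<and> b < d \<and> a * d = (int m)\<^sup>2 \<and>
     (\<forall>p. p dvd a \<longrightarrow> p dvd b \<longrightarrow> p dvd d \<longrightarrow> \<bar>p\<bar> = 1)}"

text \<open>The triple read off from the Hermite form determines the matrix of a representative and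
  hence, by \<open>coset_eqI\<close>, the coset. The map \<open>F\<close> stays existential because
  it serves only to bound cardinalities.\<close>

lemma hecke_cosets_hermite:
  assumes "m > 0"
  shows "\<exists>F. hecke_cosets m \<subseteq> F ` hermite_triples m"
proof -
  \<comment> \<open>\<open>SOME\<close> picks a lift of the matrix to the cover; either lift gives
    the same coset.\<close>
  define F where "F = (\<lambda>(a, b, d). Mp2Z #>\<^bsub>GL2_cover\<^esub>
    (SOME x. x \<in> carrier GL2_cover \<and> fst x = mat2 (real_of_int a) (of_int b) 0 (of_int d)))"
  have "hecke_cosets m \<subseteq> F ` hermite_triples m"
  proof
    fix C assume "C \<in> hecke_cosets m"
    then obtain \<delta> where \<delta>: "\<delta> \<in> double_coset m" "C = Mp2Z #>\<^bsub>GL2_cover\<^esub> \<delta>"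
      by (auto simp: hecke_cosets_def)
    have \<delta>c: "\<delta> \<in> carrier GL2_cover" using double_coset_carrier[OF assms \<delta>(1)] .
    have "\<forall>i j. fst \<delta> $ i $ j \<in> \<int>"
      using double_coset_integral(1)[OF assms \<delta>(1)] by (simp add: int_multiple_def)
    then obtain \<kappa> and a b d :: int where \<kappa>: "\<kappa> \<in> Mp2Z" "0 < a" "0 \<le> b" "b < d"
      and eq: "fst (\<kappa> \<otimes>\<^bsub>GL2_cover\<^esub> \<delta>) = mat2 (of_int a) (of_int b) 0 (of_int d)"
      using hermite_form[OF subgroup_Mp2Z T_bar_Mp2Z S_bar_Mp2Z \<delta>c] by blast
    let ?x = "\<kappa> \<otimes>\<^bsub>GL2_cover\<^esub> \<delta>"
    have xd: "?x \<in> double_coset m" using double_coset_mult_left[OF \<kappa>(1) \<delta>(1) assms] .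
    note xc = double_coset_carrier[OF assms xd]
    have "real_of_int (a * d) = of_int ((int m)\<^sup>2)"
      using double_coset_integral(2)[OF assms xd] unfolding eq by (simp add: det_mat2)
    then have "a * d = (int m)\<^sup>2" by linarith
    moreover have "\<bar>p\<bar> = 1" if "p dvd a" "p dvd b" "p dvd d" for p
    proof -
      have "int_multiple p (fst ?x)"
        using that unfolding eq by (auto simp: int_multiple_def forall_2 dvd_def)
      moreover have "p \<noteq> 0" using that(1) \<kappa>(2) by auto
      ultimately show ?thesis using double_coset_integral(3)[OF assms xd] by simp
    qed
    ultimately have "(a, b, d) \<in> hermite_triples m" using \<kappa> by (simp add: hermite_triples_def)
    moreover have "C = F (a, b, d)"
    proof -
      let ?y = "SOME x. x \<in> carrier GL2_cover \<and> fst x = mat2 (real_of_int a) (of_int b) 0 (of_int d)"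
      have y: "?y \<in> carrier GL2_cover \<and> fst ?y = mat2 (real_of_int a) (of_int b) 0 (of_int d)"
        by (rule someI[of _ ?x]) (use xc eq in auto)
      have "C = Mp2Z #>\<^bsub>GL2_cover\<^esub> ?x" using coset_mult_Mp2Z[OF \<kappa>(1) \<delta>c] \<delta>(2) by simp
      also have "\<dots> = Mp2Z #>\<^bsub>GL2_cover\<^esub> ?y" using y eq xc by (intro coset_eqI) auto
      finally show ?thesis by (simp add: F_def)
    qed
    ultimately show "C \<in> F ` hermite_triples m" by blast
  qed
  then show ?thesis by blast
qed

lemma finite_hermite_triples: "finite (hermite_triples m)"
proof (rule finite_subset)
  show "hermite_triples m \<subseteq> {0..(int m)\<^sup>2} \<times> {0..(int m)\<^sup>2} \<times> {0..(int m)\<^sup>2}"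
  proof
    fix t assume t: "t \<in> hermite_triples m"
    obtain a b d where abd: "t = (a, b, d)" by (cases t)
    have *: "0 < a" "0 \<le> b" "b < d" "a * d = (int m)\<^sup>2" using t by (auto simp: abd hermite_triples_def)
    have "a * 1 \<le> a * d" "1 * d \<le> a * d" using * by (intro mult_left_mono mult_right_mono; simp)+
    then show "t \<in> {0..(int m)\<^sup>2} \<times> {0..(int m)\<^sup>2} \<times> {0..(int m)\<^sup>2}"
      using * by (auto simp: abd)
  qed
qed simp

text \<open>The entry \<open>a\<close> is 1, \<open>p\<close> or \<open>p\<^sup>2\<close>. This
  leaves \<open>p\<^sup>2\<close> values of \<open>b\<close> in the first case, \<open>p - 1\<close>
  in the second, where primitivity excludes \<open>b = 0\<close>, and one in the third:
  \<open>p * (p + 1)\<close> in all.\<close>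

lemma card_hermite_triples_prime:
  assumes "prime p"
  shows "card (hermite_triples p) \<le> p * (p + 1)"
proof -
  let ?p = "int p"
  let ?A = "(\<lambda>b. (1, b, ?p\<^sup>2)) ` {0..<?p\<^sup>2} :: (int \<times> int \<times> int) set"
    and ?B = "(\<lambda>b. (?p, b, ?p)) ` {1..<?p} :: (int \<times> int \<times> int) set"
  have p1: "p > 1" using assms by (rule prime_gt_1_nat)
  have pi: "prime ?p" using assms by simp
  have "hermite_triples p \<subseteq> ?A \<union> ?B \<union> {(?p\<^sup>2, 0, 1)}"
  proof
    fix t assume t: "t \<in> hermite_triples p"
    obtain a b d where abd: "t = (a, b, d)" by (cases t)
    have *: "0 < a" "0 \<le> b" "b < d" "a * d = ?p\<^sup>2"
      "\<And>q. q dvd a \<Longrightarrow> q dvd b \<Longrightarrow> q dvd d \<Longrightarrow> \<bar>q\<bar> = 1"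
      using t by (auto simp: abd hermite_triples_def)
    have "a dvd ?p\<^sup>2" using *(4) by (metis dvd_triv_left)
    then obtain i where i: "i \<le> 2" "a = ?p ^ i"
      using divides_primepow[OF pi, of a 2] *(1) by auto
    consider "i = 0" | "i = 1" | "i = 2" using i(1) by linarith
    then show "t \<in> ?A \<union> ?B \<union> {(?p\<^sup>2, 0, 1)}"
    proof cases
      case 1
      then have "a = 1" "d = ?p\<^sup>2" using i *(1-4) by auto
      then show ?thesis using *(2-3) by (auto simp: abd)
    next
      case 2
      then have a: "a = ?p" using i by simp
      then have d: "d = ?p" using *(4) p1 by (simp add: power2_eq_square)
      have "b \<noteq> 0" using *(5)[of ?p] a d p1 by auto
      then show ?thesis using *(2-3) a d by (auto simp: abd)
    next
      case 3
      then have a: "a = ?p\<^sup>2" using i by simp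
      then have "d = 1" using *(4) p1 by simp
      then show ?thesis using *(2-3) a by (auto simp: abd)
    qed
  qed
  then have "card (hermite_triples p) \<le> card (?A \<union> ?B \<union> {(?p\<^sup>2, 0, 1)})"
    by (intro card_mono) auto
  also have "\<dots> \<le> card ?A + card ?B + 1"
    using card_Un_le[of "?A \<union> ?B" "{(?p\<^sup>2, 0, 1)}"] card_Un_le[of ?A ?B]
    by (simp del: Un_insert_right)
  also have "\<dots> \<le> p\<^sup>2 + (p - 1) + 1"
    using card_image_le[of "{0..<?p\<^sup>2}" "\<lambda>b. (1, b, ?p\<^sup>2)"] card_image_le[of "{1..<?p}" "\<lambda>b. (?p, b, ?p)"]
    by (intro add_mono) (auto simp: nat_power_eq)
  also have "\<dots> = p * (p + 1)" using p1 by (simp add: power2_eq_square)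
  finally show ?thesis .
qed

lemma finite_hecke_cosets:
  assumes "m > 0"
  shows "finite (hecke_cosets m)"
proof -
  obtain F where "hecke_cosets m \<subseteq> F ` hermite_triples m"
    using hecke_cosets_hermite[OF assms] by auto
  then show ?thesis by (rule finite_subset) (intro finite_imageI finite_hermite_triples)
qed

lemma card_hecke_cosets_prime:
  assumes "prime p"
  shows "card (hecke_cosets p) \<le> p * (p + 1)"
proof -
  obtain F where "hecke_cosets p \<subseteq> F ` hermite_triples p"
    using hecke_cosets_hermite[OF prime_gt_0_nat[OF assms]] by auto
  then have "card (hecke_cosets p) \<le> card (F ` hermite_triples p)"
    by (intro card_mono finite_imageI finite_hermite_triples)
  also have "\<dots> \<le> card (hermite_triples p)" by (intro card_image_le finite_hermite_triples)
  also have "\<dots> \<le> p * (p + 1)" by (rule card_hermite_triples_prime[OF assms])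
  finally show ?thesis .
qed

section \<open>Unitarity of the Weil representation\<close>

context even_lattice_form
begin

abbreviation "V \<equiv> group_algebra L \<beta>"

definition nrm :: "('a set \<Rightarrow> complex) \<Rightarrow> real" where
  "nrm v = L2_set (\<lambda>\<xi>. cmod (v \<xi>)) (carrier D)"

text \<open>Linearity is required on \<open>V\<close> only, since elements of
  \<open>BijGroup V\<close> take a dummy value elsewhere.\<close>

definition lin_op :: "(('a set \<Rightarrow> complex) \<Rightarrow> 'a set \<Rightarrow> complex) \<Rightarrow> bool" where
  "lin_op A \<longleftrightarrow> A \<in> V \<rightarrow> V \<and>
     (\<forall>u\<in>V. \<forall>v\<in>V. A (\<lambda>\<xi>. u \<xi> + v \<xi>) = (\<lambda>\<mu>. A u \<mu> + A v \<mu>)) \<and>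
     (\<forall>c. \<forall>v\<in>V. A (\<lambda>\<xi>. c * v \<xi>) = (\<lambda>\<mu>. c * A v \<mu>))"

text \<open>Built inside \<open>Bij V\<close> so that it can be a subgroup of
  \<open>BijGroup V\<close>, the group in which \<open>weil_graph\<close> is generated.\<close>

definition unitary :: "(('a set \<Rightarrow> complex) \<Rightarrow> 'a set \<Rightarrow> complex) set" where
  "unitary = {A \<in> Bij V. lin_op A \<and> (\<forall>v\<in>V. nrm (A v) = nrm v)}"

lemma group_algebra_iff: "v \<in> V \<longleftrightarrow> (\<forall>\<xi>. \<xi> \<notin> carrier D \<longrightarrow> v \<xi> = 0)"
  by (simp add: group_algebra_def)

lemma ebasis_group_algebra: "\<xi> \<in> carrier D \<Longrightarrow> ebasis \<xi> \<in> V"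
  by (auto simp: group_algebra_iff ebasis_def)

text \<open>Collapses the sum over basis vectors in \<open>hecke\<close> into one application of the
  operator, to which a norm bound applies. The induction runs over subsets of the basis because
  \<open>lin_op\<close> speaks of two summands at a time.\<close>

lemma lin_op_expand:
  assumes A: "lin_op A" and c: "c \<in> V"
  shows "A c \<mu> = (\<Sum>\<xi>\<in>carrier D. c \<xi> * A (ebasis \<xi>) \<mu>)"
proof -
  have "finite S \<Longrightarrow> S \<subseteq> carrier D \<Longrightarrow>
      A (\<lambda>\<nu>. \<Sum>\<xi>\<in>S. c \<xi> * ebasis \<xi> \<nu>) = (\<lambda>\<mu>. \<Sum>\<xi>\<in>S. c \<xi> * A (ebasis \<xi>) \<mu>)" for S
  proof (induction rule: finite_induct)
    case empty
    have "(\<lambda>_. 0) \<in> V" by (simp add: group_algebra_iff)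
    moreover have "\<forall>v\<in>V. A (\<lambda>\<xi>. 0 * v \<xi>) = (\<lambda>\<mu>. 0 * A v \<mu>)" using A unfolding lin_op_def by blast
    ultimately show ?case by fastforce
  next
    case (insert x S)
    have V: "(\<lambda>\<nu>. \<Sum>\<xi>\<in>S. c \<xi> * ebasis \<xi> \<nu>) \<in> V"
      using insert.prems by (auto simp: group_algebra_iff ebasis_def intro!: sum.neutral)
    have x: "ebasis x \<in> V" using insert.prems by (simp add: ebasis_group_algebra)
    then have xc: "(\<lambda>\<nu>. c x * ebasis x \<nu>) \<in> V" by (simp add: group_algebra_iff)
    have "A (\<lambda>\<nu>. c x * ebasis x \<nu> + (\<Sum>\<xi>\<in>S. c \<xi> * ebasis \<xi> \<nu>)) =
        (\<lambda>\<mu>. A (\<lambda>\<nu>. c x * ebasis x \<nu>) \<mu> + A (\<lambda>\<nu>. \<Sum>\<xi>\<in>S. c \<xi> * ebasis \<xi> \<nu>) \<mu>)"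
      using A xc V by (simp add: lin_op_def)
    moreover have "A (\<lambda>\<nu>. c x * ebasis x \<nu>) = (\<lambda>\<mu>. c x * A (ebasis x) \<mu>)"
      using A x by (simp add: lin_op_def)
    ultimately show ?case using insert by simp
  qed
  from this[OF finite_disc order.refl]
  have "A (\<lambda>\<nu>. \<Sum>\<xi>\<in>carrier D. c \<xi> * ebasis \<xi> \<nu>) = (\<lambda>\<mu>. \<Sum>\<xi>\<in>carrier D. c \<xi> * A (ebasis \<xi>) \<mu>)" .
  moreover have "(\<lambda>\<nu>. \<Sum>\<xi>\<in>carrier D. c \<xi> * ebasis \<xi> \<nu>) = c"
    using c finite_disc by (auto simp: ebasis_def group_algebra_iff if_distrib[of "(*) _"] cong: if_cong)
  ultimately show ?thesis by simp
qed

lemma lin_op_compose: "lin_op A \<Longrightarrow> lin_op B \<Longrightarrow> lin_op (\<lambda>v. A (B v))"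
  unfolding lin_op_def by (auto simp: Pi_iff)

lemma lin_op_lin_ext:
  assumes "\<And>\<xi>. \<xi> \<in> carrier D \<Longrightarrow> F \<xi> \<in> V"
  shows "lin_op (lin_ext L \<beta> F)"
proof -
  have V: "(\<lambda>\<xi>. u \<xi> + v \<xi>) \<in> V" "(\<lambda>\<xi>. c * v \<xi>) \<in> V" if "u \<in> V" "v \<in> V" for u v c
    using that by (auto simp: group_algebra_iff)
  have "lin_ext L \<beta> F v \<in> V" if "v \<in> V" for v
    using that assms by (auto simp: lin_ext_def group_algebra_iff intro!: sum.neutral)
  then show ?thesis
    unfolding lin_op_def using V
    by (auto simp: lin_ext_def fun_eq_iff sum.distrib distrib_right sum_distrib_left mult.assoc)
qed

lemma nrm_nonneg: "nrm v \<ge> 0"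
  by (simp add: nrm_def)

lemma nrm_sq: "of_real ((nrm v)\<^sup>2) = (\<Sum>\<xi>\<in>carrier D. v \<xi> * cnj (v \<xi>))"
proof -
  have "(nrm v)\<^sup>2 = (\<Sum>\<xi>\<in>carrier D. (cmod (v \<xi>))\<^sup>2)"
    by (simp add: nrm_def L2_set_def sum_nonneg)
  then show ?thesis by (simp only: of_real_sum complex_norm_square)
qed

lemma subgroup_unitary: "subgroup unitary (BijGroup V)"
proof (rule group.subgroupI[OF group_BijGroup])
  have car: "carrier (BijGroup V) = Bij V" by (simp add: BijGroup_def)
  show "unitary \<subseteq> carrier (BijGroup V)" by (auto simp: unitary_def car)
  have "(\<lambda>x\<in>V. x) \<in> unitary"
    by (auto simp: unitary_def id_Bij lin_op_def group_algebra_iff)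
  then show "unitary \<noteq> {}" by auto
  show "A \<otimes>\<^bsub>BijGroup V\<^esub> B \<in> unitary" if AB: "A \<in> unitary" "B \<in> unitary" for A B
  proof -
    have Bij: "A \<in> Bij V" "B \<in> Bij V" using AB by (auto simp: unitary_def)
    have "lin_op (compose V A B)"
    proof -
      have "lin_op (\<lambda>v. A (B v))" using AB by (auto simp: unitary_def intro: lin_op_compose)
      moreover have "(\<lambda>\<xi>. u \<xi> + v \<xi>) \<in> V" "(\<lambda>\<xi>. c * v \<xi>) \<in> V" if "u \<in> V" "v \<in> V" for u v c
        using that by (auto simp: group_algebra_iff)
      ultimately show ?thesis by (auto simp: lin_op_def compose_def)
    qed
    moreover have "nrm (compose V A B v) = nrm v" if "v \<in> V" for v
      using AB that by (auto simp: unitary_def compose_def lin_op_def Pi_iff)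
    ultimately show ?thesis
      using compose_Bij[OF Bij] by (simp add: unitary_def BijGroup_def Bij)
  qed
  show "inv\<^bsub>BijGroup V\<^esub> A \<in> unitary" if A: "A \<in> unitary" for A
  proof -
    have Bij: "A \<in> Bij V" and lin: "lin_op A" and iso: "\<And>v. v \<in> V \<Longrightarrow> nrm (A v) = nrm v"
      using A by (auto simp: unitary_def)
    have inj: "inj_on A V" and img: "A ` V = V" using Bij by (auto simp: Bij_def bij_betw_def)
    let ?I = "restrict (inv_into V A) V"
    have IV: "?I v \<in> V" and AI: "A (?I v) = v" if "v \<in> V" for v
      using that img by (auto intro: inv_into_into simp: f_inv_into_f)
    \<comment> \<open>Linearity of the inverse is checked by applying \<open>A\<close> to both
      sides, using that \<open>A\<close> is injective.\<close>
    have eqI: "?I v = w" if "w \<in> V" "A w = v" for v w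
      using that inj img by (metis IV AI image_eqI inj_onD)
    have clo: "(\<lambda>\<xi>. u \<xi> + v \<xi>) \<in> V" "(\<lambda>\<xi>. c * v \<xi>) \<in> V" if "u \<in> V" "v \<in> V" for u v c
      using that by (auto simp: group_algebra_iff)
    have "lin_op ?I"
      unfolding lin_op_def
    proof (intro conjI ballI allI)
      show "?I \<in> V \<rightarrow> V" using IV by auto
      fix u v assume u: "u \<in> V" and v: "v \<in> V"
      show "?I (\<lambda>\<xi>. u \<xi> + v \<xi>) = (\<lambda>\<mu>. ?I u \<mu> + ?I v \<mu>)"
      proof (rule eqI)
        show "A (\<lambda>\<mu>. ?I u \<mu> + ?I v \<mu>) = (\<lambda>\<xi>. u \<xi> + v \<xi>)"
          using lin IV[OF u] IV[OF v] AI[OF u] AI[OF v] unfolding lin_op_def by metis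
      qed (intro clo(1) IV u v)
    next
      fix c v assume v: "v \<in> V"
      show "?I (\<lambda>\<xi>. c * v \<xi>) = (\<lambda>\<mu>. c * ?I v \<mu>)"
      proof (rule eqI)
        show "A (\<lambda>\<mu>. c * ?I v \<mu>) = (\<lambda>\<xi>. c * v \<xi>)"
          using lin IV[OF v] AI[OF v] unfolding lin_op_def by metis
      qed (intro clo(2)[OF IV[OF v] IV[OF v]])
    qed
    moreover have "nrm (?I v) = nrm v" if "v \<in> V" for v
      using iso[OF IV[OF that]] AI[OF that] by simp
    moreover have "?I \<in> Bij V" using restrict_inv_into_Bij[OF Bij] .
    ultimately show ?thesis using Bij by (simp add: inv_BijGroup unitary_def)
  qed
qed

section \<open>Unitarity on the generators and on all of \<open>Mp2Z\<close>\<close>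

text \<open>Orthonormal rows make the conjugate transpose \<open>T\<close> a left inverse,
  orthonormal columns make it a right inverse. The norm is preserved because the inner product of
  \<open>?A v\<close> with itself equals that of \<open>T (?A v) = v\<close> with
  \<open>v\<close>.\<close>

lemma lin_ext_unitary:
  assumes F: "\<And>\<xi>. \<xi> \<in> carrier D \<Longrightarrow> F \<xi> \<in> V"
    and row: "\<And>\<xi> \<xi>'. \<xi> \<in> carrier D \<Longrightarrow> \<xi>' \<in> carrier D \<Longrightarrow>
      (\<Sum>\<nu>\<in>carrier D. F \<xi> \<nu> * cnj (F \<xi>' \<nu>)) = (if \<xi> = \<xi>' then 1 else 0)"
    and col: "\<And>\<nu> \<nu>'. \<nu> \<in> carrier D \<Longrightarrow> \<nu>' \<in> carrier D \<Longrightarrow>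
      (\<Sum>\<xi>\<in>carrier D. F \<xi> \<nu> * cnj (F \<xi> \<nu>')) = (if \<nu> = \<nu>' then 1 else 0)"
  shows "lin_ext L \<beta> F \<in> unitary"
proof -
  let ?A = "lin_ext L \<beta> F"
  \<comment> \<open>The cut-off outside the carrier keeps the entries of the transpose in
    \<open>V\<close>.\<close>
  define F' where "F' = (\<lambda>\<nu> \<xi>. if \<xi> \<in> carrier D then cnj (F \<xi> \<nu>) else 0)"
  define T where "T = lin_ext L \<beta> F'"
  have lin: "lin_op ?A" "lin_op T"
    using F by (auto intro!: lin_op_lin_ext simp: T_def F'_def group_algebra_iff)
  then have AV: "?A v \<in> V" "T v \<in> V" if "v \<in> V" for v
    using that by (auto simp: lin_op_def)
  have A: "?A v \<nu> = (\<Sum>\<xi>\<in>carrier D. v \<xi> * F \<xi> \<nu>)" if "v \<in> V" for v \<nu>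
    using that by (simp add: lin_ext_def)
  have B: "T v \<nu> = (\<Sum>\<xi>\<in>carrier D. v \<xi> * F' \<xi> \<nu>)" if "v \<in> V" for v \<nu>
    using that by (simp add: lin_ext_def T_def)
  have BA: "T (?A v) = v" if v: "v \<in> V" for v
  proof
    fix \<xi>'
    show "T (?A v) \<xi>' = v \<xi>'"
    proof (cases "\<xi>' \<in> carrier D")
      case True
      have "T (?A v) \<xi>' = (\<Sum>\<nu>\<in>carrier D. \<Sum>\<xi>\<in>carrier D. v \<xi> * (F \<xi> \<nu> * cnj (F \<xi>' \<nu>)))"
        using True by (simp add: A[OF v] B[OF AV(1)[OF v]] F'_def sum_distrib_right mult.assoc)
      also have "\<dots> = (\<Sum>\<xi>\<in>carrier D. v \<xi> * (\<Sum>\<nu>\<in>carrier D. F \<xi> \<nu> * cnj (F \<xi>' \<nu>)))"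
        by (subst sum.swap) (simp add: sum_distrib_left)
      also have "\<dots> = (\<Sum>\<xi>\<in>carrier D. if \<xi> = \<xi>' then v \<xi>' else 0)"
        using row True by (intro sum.cong) auto
      finally show ?thesis using True finite_disc by simp
    next
      case False
      then show ?thesis using v AV by (auto simp: group_algebra_iff)
    qed
  qed
  have AB: "?A (T v) = v" if v: "v \<in> V" for v
  proof
    fix \<nu>'
    show "?A (T v) \<nu>' = v \<nu>'"
    proof (cases "\<nu>' \<in> carrier D")
      case True
      have "?A (T v) \<nu>' = (\<Sum>\<xi>\<in>carrier D. \<Sum>\<nu>\<in>carrier D. v \<nu> * (F \<xi> \<nu>' * cnj (F \<xi> \<nu>)))"
        using True by (simp add: B[OF v] A[OF AV(2)[OF v]] F'_def sum_distrib_left sum_distrib_right mult_ac)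
      also have "\<dots> = (\<Sum>\<nu>\<in>carrier D. v \<nu> * (\<Sum>\<xi>\<in>carrier D. F \<xi> \<nu>' * cnj (F \<xi> \<nu>)))"
        by (subst sum.swap) (simp add: sum_distrib_left)
      also have "\<dots> = (\<Sum>\<nu>\<in>carrier D. if \<nu> = \<nu>' then v \<nu>' else 0)"
        using col True by (intro sum.cong) auto
      finally show ?thesis using True finite_disc by simp
    next
      case False
      then show ?thesis using v AV by (auto simp: group_algebra_iff)
    qed
  qed
  have "bij_betw ?A V V"
    by (rule bij_betw_byWitness[of _ T]) (use AV AB BA in auto)
  moreover have "?A \<in> extensional V" by (simp add: lin_ext_def)
  moreover have "nrm (?A v) = nrm v" if v: "v \<in> V" for v
  proof -
    have "complex_of_real ((nrm (?A v))\<^sup>2) = (\<Sum>\<nu>\<in>carrier D. ?A v \<nu> * cnj (\<Sum>\<xi>\<in>carrier D. v \<xi> * F \<xi> \<nu>))"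
      unfolding nrm_sq by (simp add: A[OF v])
    also have "\<dots> = (\<Sum>\<nu>\<in>carrier D. \<Sum>\<xi>\<in>carrier D. cnj (v \<xi>) * (?A v \<nu> * cnj (F \<xi> \<nu>)))"
      by (simp add: sum_distrib_left mult_ac)
    also have "\<dots> = (\<Sum>\<xi>\<in>carrier D. cnj (v \<xi>) * (\<Sum>\<nu>\<in>carrier D. ?A v \<nu> * cnj (F \<xi> \<nu>)))"
      by (subst sum.swap) (simp add: sum_distrib_left)
    also have "\<dots> = (\<Sum>\<xi>\<in>carrier D. cnj (v \<xi>) * T (?A v) \<xi>)"
      by (intro sum.cong) (auto simp: B[OF AV(1)[OF v]] F'_def)
    also have "\<dots> = complex_of_real ((nrm v)\<^sup>2)"
      unfolding nrm_sq BA[OF v] by (simp add: mult.commute)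
    finally have "(nrm (?A v))\<^sup>2 = (nrm v)\<^sup>2" by (simp only: of_real_eq_iff)
    then show ?thesis by (simp add: nrm_nonneg power2_eq_iff_nonneg)
  qed
  ultimately show ?thesis using lin by (simp add: unitary_def Bij_def)
qed

lemma e_mult_cnj: "e (of_real x) * cnj (e (of_real x)) = 1"
  using complex_norm_square[of "e (of_real x)"] by (simp add: cmod_e_of_real)

lemma weil_T_unitary: "weil_T L \<beta> \<in> unitary"
  unfolding weil_T_def
proof (rule lin_ext_unitary)
  fix \<xi> assume "\<xi> \<in> carrier D"
  then show "(\<lambda>\<nu>. e (of_real (disc_quad \<beta> \<xi>)) * ebasis \<xi> \<nu>) \<in> V"
    by (auto simp: group_algebra_iff ebasis_def)
next
  fix \<xi> \<xi>' assume x: "\<xi> \<in> carrier D" "\<xi>' \<in> carrier D"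
  let ?F = "\<lambda>\<xi> \<nu>. e (of_real (disc_quad \<beta> \<xi>)) * ebasis \<xi> \<nu>"
  have "(\<Sum>\<nu>\<in>carrier D. ?F \<xi> \<nu> * cnj (?F \<xi>' \<nu>)) = (\<Sum>\<nu>\<in>carrier D. if \<nu> = \<xi> then if \<xi> = \<xi>' then 1 else 0 else 0)"
    by (intro sum.cong) (auto simp: ebasis_def e_mult_cnj)
  then show "(\<Sum>\<nu>\<in>carrier D. ?F \<xi> \<nu> * cnj (?F \<xi>' \<nu>)) = (if \<xi> = \<xi>' then 1 else 0)"
    using x finite_disc by simp
  have "(\<Sum>\<nu>\<in>carrier D. ?F \<nu> \<xi> * cnj (?F \<nu> \<xi>')) = (\<Sum>\<nu>\<in>carrier D. if \<nu> = \<xi> then if \<xi> = \<xi>' then 1 else 0 else 0)"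
    by (intro sum.cong) (auto simp: ebasis_def e_mult_cnj)
  then show "(\<Sum>\<nu>\<in>carrier D. ?F \<nu> \<xi> * cnj (?F \<nu> \<xi>')) = (if \<xi> = \<xi>' then 1 else 0)"
    using x finite_disc by simp
qed

text \<open>Character orthogonality produces the factor \<open>card (carrier D)\<close>, and the
  squared modulus of the scalar \<open>c\<close> cancels it. The columns follow from the rows
  because \<open>disc_char\<close> is symmetric.\<close>

lemma weil_S_unitary: "weil_S L \<beta> \<in> unitary"
proof -
  let ?n = "card (carrier D)"
  define c where "c = e (- of_int (lattice_sig L \<beta>) / 8) / of_real (sqrt (real ?n))"
  let ?F = "\<lambda>\<xi> \<nu>. c * (if \<nu> \<in> carrier D then disc_char \<xi> \<nu> else 0)"
  have S: "weil_S L \<beta> = lin_ext L \<beta> ?F"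
  proof -
    have "(\<Sum>\<mu>\<in>carrier D. disc_char \<xi> \<mu> * ebasis \<mu> \<nu>) = (if \<nu> \<in> carrier D then disc_char \<xi> \<nu> else 0)" for \<xi> \<nu>
      using finite_disc by (simp add: ebasis_def if_distrib[of "(*) _"] cong: if_cong)
    then show ?thesis unfolding weil_S_def disc_char_def[symmetric] c_def by simp
  qed
  have n: "?n > 0" using finite_disc disc.one_closed by (auto simp: card_gt_0_iff)
  have "e (- of_int (lattice_sig L \<beta>) / 8) = e (of_real (- of_int (lattice_sig L \<beta>) / 8))" by simp
  then have "cmod c = 1 / sqrt (real ?n)"
    unfolding c_def norm_divide by (simp only: cmod_e_of_real) simp
  then have "(cmod c)\<^sup>2 = 1 / real ?n" by (simp add: power_divide)
  then have cc: "c * cnj c = 1 / of_nat ?n" by (metis complex_norm_square of_real_1 of_real_divide of_real_of_nat_eq)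
  have orth: "(\<Sum>\<nu>\<in>carrier D. ?F \<xi> \<nu> * cnj (?F \<xi>' \<nu>)) = (if \<xi> = \<xi>' then 1 else 0)"
    if "\<xi> \<in> carrier D" "\<xi>' \<in> carrier D" for \<xi> \<xi>'
  proof -
    have "(\<Sum>\<nu>\<in>carrier D. ?F \<xi> \<nu> * cnj (?F \<xi>' \<nu>)) = (\<Sum>\<nu>\<in>carrier D. (c * cnj c) * (disc_char \<xi> \<nu> * cnj (disc_char \<xi>' \<nu>)))"
      by (intro sum.cong) (auto simp: mult_ac)
    also have "\<dots> = (c * cnj c) * (if \<xi> = \<xi>' then of_nat ?n else 0)"
      using disc_char_orthogonality[OF that] by (simp only: sum_distrib_left[symmetric])
    finally show ?thesis using n by (simp add: cc)
  qed
  show ?thesis unfolding S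
  proof (rule lin_ext_unitary)
    show "?F \<xi> \<in> V" for \<xi> by (simp add: group_algebra_iff)
    show "(\<Sum>\<nu>\<in>carrier D. ?F \<xi> \<nu> * cnj (?F \<xi>' \<nu>)) = (if \<xi> = \<xi>' then 1 else 0)"
      if "\<xi> \<in> carrier D" "\<xi>' \<in> carrier D" for \<xi> \<xi>' using orth[OF that] .
    show "(\<Sum>\<nu>\<in>carrier D. ?F \<nu> \<xi> * cnj (?F \<nu> \<xi>')) = (if \<xi> = \<xi>' then 1 else 0)"
      if "\<xi> \<in> carrier D" "\<xi>' \<in> carrier D" for \<xi> \<xi>'
      using orth[OF that] that by (simp add: disc_char_sym[of _ \<xi>] disc_char_sym[of _ \<xi>'])
  qed
qed

text \<open>The graph is generated inside the subgroup \<open>Mp2Z \<times> unitary\<close> and so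
  stays there. Its first projection is a subgroup containing \<open>T_bar\<close> and
  \<open>S_bar\<close>, hence all of \<open>Mp2Z\<close>; so \<open>SOME\<close> selects from a
  nonempty set, each member of which is unitary.\<close>

lemma weil_rep_unitary:
  assumes "\<gamma> \<in> Mp2Z"
  shows "weil_rep L \<beta> \<gamma> \<in> unitary"
proof -
  let ?M = "GL2_cover\<lparr>carrier := Mp2Z\<rparr>"
  let ?P = "?M \<times>\<times> BijGroup V"
  interpret M: group ?M by (rule GL2.subgroup_imp_group[OF subgroup_Mp2Z])
  interpret P: group ?P by (intro DirProd_group M.is_group group_BijGroup)
  have gen: "{(T_bar, weil_T L \<beta>), (S_bar, weil_S L \<beta>)} \<subseteq> Mp2Z \<times> unitary"
    using T_bar_Mp2Z S_bar_Mp2Z weil_T_unitary weil_S_unitary by auto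
  have sub: "subgroup (Mp2Z \<times> unitary) ?P"
    using DirProd_subgroups[OF M.is_group M.subgroup_self group_BijGroup subgroup_unitary] by simp
  have incl: "weil_graph L \<beta> \<subseteq> Mp2Z \<times> unitary"
    unfolding weil_graph_def by (rule P.generate_subgroup_incl[OF gen sub])
  have graph: "subgroup (weil_graph L \<beta>) ?P"
    unfolding weil_graph_def using gen subgroup.subset[OF sub] by (intro P.generate_is_subgroup) blast
  have memT: "(T_bar, weil_T L \<beta>) \<in> weil_graph L \<beta>" "(S_bar, weil_S L \<beta>) \<in> weil_graph L \<beta>"
    unfolding weil_graph_def by (auto intro: generate.incl)
  have K: "subgroup (fst ` weil_graph L \<beta>) GL2_cover"
  proof (rule GL2.subgroupI)
    show "fst ` weil_graph L \<beta> \<subseteq> carrier GL2_cover" using incl Mp2Z.subset by auto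
    show "fst ` weil_graph L \<beta> \<noteq> {}" using memT by auto
    show "inv\<^bsub>GL2_cover\<^esub> a \<in> fst ` weil_graph L \<beta>" if a: "a \<in> fst ` weil_graph L \<beta>" for a
    proof -
      obtain A where A: "(a, A) \<in> weil_graph L \<beta>" using a by auto
      have aM: "a \<in> Mp2Z" and "A \<in> carrier (BijGroup V)" using A incl subgroup.subset[OF subgroup_unitary] by auto
      then have "inv\<^bsub>?P\<^esub> (a, A) = (inv\<^bsub>?M\<^esub> a, inv\<^bsub>BijGroup V\<^esub> A)"
        by (intro inv_DirProd M.is_group group_BijGroup) auto
      moreover have "inv\<^bsub>?M\<^esub> a = inv\<^bsub>GL2_cover\<^esub> a"
        using aM by (intro GL2.m_inv_consistent subgroup_Mp2Z)
      ultimately show ?thesis using subgroup.m_inv_closed[OF graph A] by force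
    qed
    show "a \<otimes>\<^bsub>GL2_cover\<^esub> b \<in> fst ` weil_graph L \<beta>"
      if ab: "a \<in> fst ` weil_graph L \<beta>" "b \<in> fst ` weil_graph L \<beta>" for a b
    proof -
      obtain A B where A: "(a, A) \<in> weil_graph L \<beta>" and B: "(b, B) \<in> weil_graph L \<beta>" using ab by auto
      show ?thesis using subgroup.m_closed[OF graph A B] by force
    qed
  qed
  have "Mp2Z \<subseteq> fst ` weil_graph L \<beta>"
    using memT by (intro Mp2Z_generated K) force+
  then obtain A where "(\<gamma>, A) \<in> weil_graph L \<beta>" using assms by force
  then have "(\<gamma>, weil_rep L \<beta> \<gamma>) \<in> weil_graph L \<beta>" unfolding weil_rep_def by (rule someI[of "\<lambda>A. (\<gamma>, A) \<in> weil_graph L \<beta>"])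
  then show ?thesis using incl by auto
qed

lemma act_Mp2Z_unitary: "\<gamma> \<in> Mp2Z \<Longrightarrow> act_Mp2Z L \<beta> \<gamma> \<in> unitary"
  unfolding act_Mp2Z_def using weil_rep_unitary by (intro subgroup.m_inv_closed[OF subgroup_unitary])

end

section \<open>The Petersson function of a cusp form\<close>

context even_lattice_form
begin

section \<open>Norm estimates for the operators on the group algebra\<close>

lemma nrm_add_le: "nrm (\<lambda>\<xi>. u \<xi> + v \<xi>) \<le> nrm u + nrm v"
proof -
  have "nrm (\<lambda>\<xi>. u \<xi> + v \<xi>) \<le> L2_set (\<lambda>\<xi>. cmod (u \<xi>) + cmod (v \<xi>)) (carrier D)"
    unfolding nrm_def by (intro L2_set_mono) (auto simp: norm_triangle_ineq)
  also have "\<dots> \<le> nrm u + nrm v" unfolding nrm_def by (rule L2_set_triangle_ineq)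
  finally show ?thesis .
qed

lemma nrm_scale: "nrm (\<lambda>\<xi>. c * v \<xi>) = cmod c * nrm v"
  by (simp add: nrm_def norm_mult L2_set_right_distrib)

lemma nrm_sum_le: "finite S \<Longrightarrow> nrm (\<lambda>\<mu>. \<Sum>C\<in>S. x C \<mu>) \<le> (\<Sum>C\<in>S. nrm (x C))"
proof (induction rule: finite_induct)
  case empty
  then show ?case by (simp add: nrm_def L2_set_def)
next
  case (insert C S)
  then show ?case using nrm_add_le[of "x C" "\<lambda>\<mu>. \<Sum>C\<in>S. x C \<mu>"] by simp
qed

lemma nrm_le_sum: "nrm v \<le> (\<Sum>\<xi>\<in>carrier D. cmod (v \<xi>))"
  unfolding nrm_def by (rule L2_set_le_sum) simp

lemma nrm_eq_0: "v \<in> V \<Longrightarrow> nrm v = 0 \<Longrightarrow> v = (\<lambda>_. 0)"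
  using finite_disc by (auto simp: nrm_def L2_set_eq_0_iff group_algebra_iff fun_eq_iff)

lemma lin_op_act_g_sq: "lin_op (act_g_sq L \<beta> m)"
  unfolding act_g_sq_def by (rule lin_op_lin_ext) (simp add: ebasis_group_algebra)

lemma nrm_act_g_sq:
  assumes "v \<in> V"
  shows "nrm (act_g_sq L \<beta> m v) \<le> sqrt (card (torsion L \<beta> m)) * nrm v"
proof -
  let ?t = "real (card (torsion L \<beta> m))"
  let ?A = "act_g_sq L \<beta> m v"
  let ?fib = "\<lambda>\<mu>. {\<xi> \<in> carrier D. \<xi> [^]\<^bsub>D\<^esub> m = \<mu>}"
  have A: "?A \<mu> = (\<Sum>\<xi>\<in>?fib \<mu>. v \<xi>)" for \<mu>
  proof -
    have "?A \<mu> = (\<Sum>\<xi>\<in>carrier D. if \<xi> [^]\<^bsub>D\<^esub> m = \<mu> then v \<xi> else 0)"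
      using assms by (auto simp: act_g_sq_def lin_ext_def ebasis_def intro!: sum.cong)
    also have "\<dots> = (\<Sum>\<xi>\<in>?fib \<mu>. v \<xi>)"
      using finite_disc by (simp add: sum.inter_filter)
    finally show ?thesis .
  qed
  have le: "(cmod (?A \<mu>))\<^sup>2 \<le> ?t * (\<Sum>\<xi>\<in>?fib \<mu>. (cmod (v \<xi>))\<^sup>2)" for \<mu>
  proof -
    have "cmod (?A \<mu>) \<le> (\<Sum>\<xi>\<in>?fib \<mu>. 1 * cmod (v \<xi>))" unfolding A by (simp add: norm_sum)
    then have "(cmod (?A \<mu>))\<^sup>2 \<le> (\<Sum>\<xi>\<in>?fib \<mu>. 1 * cmod (v \<xi>))\<^sup>2" by (intro power_mono) auto
    also have "\<dots> \<le> (\<Sum>\<xi>\<in>?fib \<mu>. 1\<^sup>2) * (\<Sum>\<xi>\<in>?fib \<mu>. (cmod (v \<xi>))\<^sup>2)"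
      by (rule Cauchy_Schwarz_ineq_sum)
    also have "\<dots> \<le> ?t * (\<Sum>\<xi>\<in>?fib \<mu>. (cmod (v \<xi>))\<^sup>2)"
      using card_pow_fibre_le[OF disc.comm_group_axioms finite_disc, of m \<mu>]
      by (intro mult_right_mono) (auto simp: torsion_def sum_nonneg)
    finally show ?thesis .
  qed
  have "(nrm ?A)\<^sup>2 = (\<Sum>\<mu>\<in>carrier D. (cmod (?A \<mu>))\<^sup>2)" by (simp add: nrm_def L2_set_def sum_nonneg)
  also have "\<dots> \<le> (\<Sum>\<mu>\<in>carrier D. ?t * (\<Sum>\<xi>\<in>?fib \<mu>. (cmod (v \<xi>))\<^sup>2))" by (intro sum_mono le)
  \<comment> \<open>The fibres of the power map partition the carrier, so the double sum runs over
    each element once.\<close>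
  also have "\<dots> = ?t * (\<Sum>\<xi>\<in>carrier D. (cmod (v \<xi>))\<^sup>2)"
    using finite_disc by (subst sum_distrib_left[symmetric], subst sum.group) auto
  also have "\<dots> = (sqrt ?t * nrm v)\<^sup>2"
    by (simp add: nrm_def L2_set_def sum_nonneg power_mult_distrib)
  finally show ?thesis by (rule power2_le_imp_le) (simp add: nrm_nonneg)
qed

text \<open>Whichever decomposition \<open>SOME\<close> picks, its outer factors act as isometries,
  so only \<open>act_g_sq\<close> contributes to the bound.\<close>

lemma act_double_bound:
  assumes "\<delta> \<in> double_coset m"
  shows "lin_op (act_double L \<beta> m \<delta>)"
    and "v \<in> V \<Longrightarrow> nrm (act_double L \<beta> m \<delta> v) \<le> sqrt (card (torsion L \<beta> m)) * nrm v"
proof -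
  define p where "p = (SOME (\<gamma>, \<gamma>'). \<gamma> \<in> Mp2Z \<and> \<gamma>' \<in> Mp2Z \<and>
    \<delta> = \<gamma> \<otimes>\<^bsub>GL2_cover\<^esub> g_sq m \<otimes>\<^bsub>GL2_cover\<^esub> \<gamma>')"
  have "\<exists>p. case p of (\<gamma>, \<gamma>') \<Rightarrow> \<gamma> \<in> Mp2Z \<and> \<gamma>' \<in> Mp2Z \<and>
    \<delta> = \<gamma> \<otimes>\<^bsub>GL2_cover\<^esub> g_sq m \<otimes>\<^bsub>GL2_cover\<^esub> \<gamma>'"
    using assms by (auto simp: double_coset_def)
  then have "case p of (\<gamma>, \<gamma>') \<Rightarrow> \<gamma> \<in> Mp2Z \<and> \<gamma>' \<in> Mp2Z \<and>
    \<delta> = \<gamma> \<otimes>\<^bsub>GL2_cover\<^esub> g_sq m \<otimes>\<^bsub>GL2_cover\<^esub> \<gamma>'"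
    unfolding p_def by (rule someI_ex)
  then have p: "fst p \<in> Mp2Z" "snd p \<in> Mp2Z" by (auto simp: case_prod_beta)
  let ?A = "act_Mp2Z L \<beta> (fst p)" and ?B = "act_Mp2Z L \<beta> (snd p)" and ?g = "act_g_sq L \<beta> m"
  have AB: "?A \<in> unitary" "?B \<in> unitary" using p by (auto intro: act_Mp2Z_unitary)
  have eq: "act_double L \<beta> m \<delta> = (\<lambda>v. ?B (?g (?A v)))"
    unfolding act_double_def p_def[symmetric] Let_def by (simp add: case_prod_beta)
  have lin: "lin_op ?A" "lin_op ?B" using AB by (auto simp: unitary_def)
  then show "lin_op (act_double L \<beta> m \<delta>)"
    unfolding eq by (intro lin_op_compose[OF lin(2) lin_op_compose[OF lin_op_act_g_sq lin(1)]])
  show "nrm (act_double L \<beta> m \<delta> v) \<le> sqrt (card (torsion L \<beta> m)) * nrm v" if v: "v \<in> V"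
  proof -
    have Av: "?A v \<in> V" using lin v by (auto simp: lin_op_def)
    then have "?g (?A v) \<in> V" using lin_op_act_g_sq[of m] by (auto simp: lin_op_def)
    then have "nrm (act_double L \<beta> m \<delta> v) = nrm (?g (?A v))" using AB by (simp add: eq unitary_def)
    also have "\<dots> \<le> sqrt (card (torsion L \<beta> m)) * nrm (?A v)" by (rule nrm_act_g_sq[OF Av])
    also have "nrm (?A v) = nrm v" using AB v by (simp add: unitary_def)
    finally show ?thesis .
  qed
qed

lemma card_torsion_ge_1: "card (torsion L \<beta> m) \<ge> 1"
proof -
  have "\<one>\<^bsub>D\<^esub> \<in> torsion L \<beta> m" by (simp add: torsion_def)
  moreover have "finite (torsion L \<beta> m)" using finite_disc by (simp add: torsion_def)
  ultimately have "card (torsion L \<beta> m) > 0" by (auto simp: card_gt_0_iff)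
  then show ?thesis by simp
qed

end

section \<open>Invariance of the Petersson function and its link to the Hecke operator\<close>

locale cusp_form = even_lattice_form L \<beta> for L :: "'a::real_vector set" and \<beta> +
  fixes k :: real and f :: "complex \<Rightarrow> 'a set \<Rightarrow> complex"
  assumes half_integral: "2 * k \<in> \<int>" and cusp: "f \<in> cusp_forms L \<beta> k"
begin

lemma f_group_algebra: "\<tau> \<in> upper_half \<Longrightarrow> f \<tau> \<in> V"
  using cusp by (simp add: cusp_forms_def)

definition pet :: "complex \<Rightarrow> real" where
  "pet \<tau> = Im \<tau> powr (k / 2) * nrm (f \<tau>)"

text \<open>\<open>2 * k\<close> is an integer, so the floor is exact; and the modulus of
  \<open>\<phi> \<tau>\<close> is determined by its square, hence by the matrix alone.\<close>

lemma cmod_phi_powi: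
  assumes "(\<gamma>, \<phi>) \<in> carrier GL2_cover" "\<tau> \<in> upper_half"
  shows "cmod (\<phi> \<tau> powi \<lfloor>2 * k\<rfloor>) = cmod (auto_factor \<gamma> \<tau>) powr k"
    and "cmod (\<phi> \<tau> powi (- \<lfloor>2 * k\<rfloor>)) = cmod (auto_factor \<gamma> \<tau>) powr (- k)"
proof -
  have sq: "(\<phi> \<tau>)\<^sup>2 = auto_factor \<gamma> \<tau>" and "auto_factor \<gamma> \<tau> \<noteq> 0"
    using assms auto_factor_nonzero by (auto simp: carrier_GL2_iff)
  then have pos: "cmod (\<phi> \<tau>) > 0" by auto
  have "cmod (auto_factor \<gamma> \<tau>) = cmod (\<phi> \<tau>) powr 2"
    using pos by (simp add: sq[symmetric] norm_power)
  then have p: "cmod (auto_factor \<gamma> \<tau>) powr x = cmod (\<phi> \<tau>) powr (2 * x)" for x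
    by (simp only: powr_powr)
  have i: "of_int \<lfloor>2 * k\<rfloor> = 2 * k" using half_integral by simp
  show "cmod (\<phi> \<tau> powi \<lfloor>2 * k\<rfloor>) = cmod (auto_factor \<gamma> \<tau>) powr k"
    using powr_real_of_int'[of "cmod (\<phi> \<tau>)" "\<lfloor>2 * k\<rfloor>"] pos i by (simp add: p norm_power_int)
  show "cmod (\<phi> \<tau> powi (- \<lfloor>2 * k\<rfloor>)) = cmod (auto_factor \<gamma> \<tau>) powr (- k)"
    using powr_real_of_int'[of "cmod (\<phi> \<tau>)" "- \<lfloor>2 * k\<rfloor>"] pos i by (simp add: p norm_power_int)
qed

lemma Im_moebius_powr:
  assumes "det \<gamma> > 0" "\<tau> \<in> upper_half"
  shows "Im (moebius \<gamma> \<tau>) powr (k / 2) =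
    det \<gamma> powr (k / 2) * Im \<tau> powr (k / 2) * cmod (auto_factor \<gamma> \<tau>) powr (- k)"
proof -
  have pos: "cmod (auto_factor \<gamma> \<tau>) > 0" "Im \<tau> > 0"
    using auto_factor_nonzero[OF assms] assms(2) by (auto simp: upper_half_def)
  have "(cmod (auto_factor \<gamma> \<tau>))\<^sup>2 = cmod (auto_factor \<gamma> \<tau>) powr 2" using pos by simp
  then have "((cmod (auto_factor \<gamma> \<tau>))\<^sup>2) powr (k / 2) = cmod (auto_factor \<gamma> \<tau>) powr k"
    by (simp only: powr_powr) simp
  moreover have "Im (moebius \<gamma> \<tau>) powr (k / 2) =
      (det \<gamma> * Im \<tau>) powr (k / 2) / ((cmod (auto_factor \<gamma> \<tau>))\<^sup>2) powr (k / 2)"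
    unfolding Im_moebius by (rule powr_divide)
  moreover have "(det \<gamma> * Im \<tau>) powr (k / 2) = det \<gamma> powr (k / 2) * Im \<tau> powr (k / 2)"
    by (rule powr_mult)
  ultimately show ?thesis by (simp only: powr_minus divide_inverse)
qed

text \<open>The modulus of the automorphy factor enters with exponent \<open>k\<close> through
  \<open>f\<close> and with exponent \<open>- k\<close> through the imaginary part.\<close>

lemma pet_invariant:
  assumes "x \<in> Mp2Z" "\<tau> \<in> upper_half"
  shows "pet (moebius (fst x) \<tau>) = pet \<tau>"
proof -
  obtain \<gamma> \<phi> where x: "x = (\<gamma>, \<phi>)" by (cases x)
  have c: "(\<gamma>, \<phi>) \<in> carrier GL2_cover" "det \<gamma> = 1" using assms(1) by (auto simp: x Mp2Z_iff)
  have "f (moebius \<gamma> \<tau>) = (\<lambda>\<mu>. \<phi> \<tau> powi \<lfloor>2 * k\<rfloor> * weil_rep L \<beta> (\<gamma>, \<phi>) (f \<tau>) \<mu>)"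
    using cusp assms by (force simp: cusp_forms_def x)
  then have "nrm (f (moebius \<gamma> \<tau>)) = cmod (auto_factor \<gamma> \<tau>) powr k * nrm (f \<tau>)"
    using weil_rep_unitary[OF assms(1)] f_group_algebra[OF assms(2)]
    by (simp add: nrm_scale cmod_phi_powi[OF c(1) assms(2)] unitary_def x)
  moreover have "cmod (auto_factor \<gamma> \<tau>) > 0" using auto_factor_nonzero[of \<gamma>] c(2) assms(2) by auto
  ultimately show ?thesis
    using c(2) Im_moebius_powr[of \<gamma> \<tau>] assms(2) by (simp add: pet_def x powr_minus)
qed

text \<open>The determinant factor in \<open>slash\<close> is exactly the one by which
  \<open>Im_moebius_powr\<close> scales, so no constant remains.\<close>

lemma slash_pet:
  assumes "\<delta> \<in> carrier GL2_cover" "\<tau> \<in> upper_half"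
  shows "Im \<tau> powr (k / 2) * nrm (\<lambda>\<xi>. slash k \<delta> (\<lambda>z. f z \<xi>) \<tau>) = pet (moebius (fst \<delta>) \<tau>)"
proof -
  obtain \<gamma> \<phi> where x: "\<delta> = (\<gamma>, \<phi>)" by (cases \<delta>)
  have c: "(\<gamma>, \<phi>) \<in> carrier GL2_cover" "det \<gamma> > 0" using assms(1) by (auto simp: x carrier_GL2_iff)
  have "nrm (\<lambda>\<xi>. slash k \<delta> (\<lambda>z. f z \<xi>) \<tau>) =
      det \<gamma> powr (k / 2) * cmod (auto_factor \<gamma> \<tau>) powr (- k) * nrm (f (moebius \<gamma> \<tau>))"
    by (simp add: slash_def x nrm_scale norm_mult cmod_phi_powi[OF c(1) assms(2)])
  then show ?thesis
    by (simp add: pet_def x Im_moebius_powr[OF c(2) assms(2)])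
qed

text \<open>The values of \<open>pet\<close> are kept as a sum rather than replaced by a maximum:
  strictness is going to come from a single summand.\<close>

lemma hecke_bound:
  assumes "m > 0" "\<tau> \<in> upper_half"
  shows "nrm (hecke L \<beta> k m f \<tau>) * Im \<tau> powr (k / 2) \<le> real m powr (k - 2) *
    (sqrt (card (torsion L \<beta> m)) * (\<Sum>C\<in>hecke_cosets m. pet (moebius (fst (SOME \<delta>. \<delta> \<in> C)) \<tau>)))"
proof -
  let ?t = "sqrt (card (torsion L \<beta> m))"
  let ?\<delta> = "\<lambda>C :: mp set. SOME \<delta>. \<delta> \<in> C"
  let ?s = "\<lambda>C \<xi>. slash k (?\<delta> C) (\<lambda>z. f z \<xi>) \<tau>"
  have \<delta>: "?\<delta> C \<in> double_coset m" if "C \<in> hecke_cosets m" for C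
    using hecke_coset_rep[OF assms(1) that] by auto
  have sV: "?s C \<in> V" if "C \<in> hecke_cosets m" for C
  proof -
    have "?\<delta> C \<in> carrier GL2_cover" using \<delta>[OF that] double_coset_carrier[OF assms(1)] by auto
    then have "moebius (fst (?\<delta> C)) \<tau> \<in> upper_half"
      using moebius_upper_half assms(2) by (cases "?\<delta> C") (auto simp: carrier_GL2_iff)
    then show ?thesis
      using f_group_algebra by (cases "?\<delta> C") (auto simp: slash_def group_algebra_iff)
  qed
  have "hecke L \<beta> k m f \<tau> = (\<lambda>\<mu>. of_real (real m powr (k - 2)) *
      (\<Sum>C\<in>hecke_cosets m. act_double L \<beta> m (?\<delta> C) (?s C) \<mu>))"
    unfolding hecke_def Let_def
    using lin_op_expand[OF act_double_bound(1)[OF \<delta>] sV] by simp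
  then have "nrm (hecke L \<beta> k m f \<tau>) =
      real m powr (k - 2) * nrm (\<lambda>\<mu>. \<Sum>C\<in>hecke_cosets m. act_double L \<beta> m (?\<delta> C) (?s C) \<mu>)"
    by (simp add: nrm_scale)
  also have "\<dots> \<le> real m powr (k - 2) * (\<Sum>C\<in>hecke_cosets m. nrm (act_double L \<beta> m (?\<delta> C) (?s C)))"
    by (intro mult_left_mono nrm_sum_le finite_hecke_cosets assms) simp
  also have "\<dots> \<le> real m powr (k - 2) * (\<Sum>C\<in>hecke_cosets m. ?t * nrm (?s C))"
    by (intro mult_left_mono sum_mono act_double_bound(2) \<delta> sV) auto
  finally have "nrm (hecke L \<beta> k m f \<tau>) * Im \<tau> powr (k / 2) \<le>
      real m powr (k - 2) * (\<Sum>C\<in>hecke_cosets m. ?t * nrm (?s C)) * Im \<tau> powr (k / 2)"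
    by (rule mult_right_mono) simp
  also have "\<dots> = real m powr (k - 2) * (?t * (\<Sum>C\<in>hecke_cosets m. Im \<tau> powr (k / 2) * nrm (?s C)))"
    by (simp add: sum_distrib_left sum_distrib_right mult_ac)
  also have "(\<Sum>C\<in>hecke_cosets m. Im \<tau> powr (k / 2) * nrm (?s C)) =
      (\<Sum>C\<in>hecke_cosets m. pet (moebius (fst (?\<delta> C)) \<tau>))"
    using \<delta> double_coset_carrier[OF assms(1)] by (intro sum.cong slash_pet assms(2)) auto
  finally show ?thesis .
qed

section \<open>Decay at the cusp and existence of a maximum\<close>

text \<open>The exponents are positive and lie in one class modulo 1, so they stay above some
  \<open>n0 > 0\<close>. Convergence at \<open>\<i>\<close> is absolute and dominates every point
  with imaginary part at least 1; each term gains a further factor of at most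
  \<open>exp (- 2 * pi * n0 * (Im \<tau> - 1))\<close>. This explains the shift by 1, and
  \<open>C\<close> is the sum of the moduli at \<open>\<i>\<close>.\<close>

lemma component_decay:
  assumes "\<xi> \<in> carrier D"
  shows "\<exists>C c. 0 < c \<and> (\<forall>\<tau>. Im \<tau> \<ge> 1 \<longrightarrow> cmod (f \<tau> \<xi>) \<le> C * exp (- c * (Im \<tau> - 1)))"
proof -
  let ?S = "{n::real. n - disc_quad \<beta> \<xi> \<in> \<int> \<and> n > 0}"
  obtain a where a: "\<And>\<tau>. \<tau> \<in> upper_half \<Longrightarrow> ((\<lambda>n. a n * e (of_real n * \<tau>)) has_sum f \<tau> \<xi>) ?S"
    using cusp assms by (force simp: cusp_forms_def)
  define q where "q = disc_quad \<beta> \<xi>"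
  \<comment> \<open>The least positive real number congruent to \<open>q\<close> modulo 1; it is 1
    when \<open>q\<close> is an integer.\<close>
  define n0 where "n0 = q + of_int \<lfloor>- q\<rfloor> + 1"
  have n0: "n0 > 0" unfolding n0_def by linarith
  have S: "n \<ge> n0" if "n \<in> ?S" for n
  proof -
    obtain z :: int where z: "n - q = of_int z" using \<open>n \<in> ?S\<close> by (auto simp: q_def elim: Ints_cases)
    then have "- q < of_int z" using \<open>n \<in> ?S\<close> by (simp add: algebra_simps)
    then have "\<lfloor>- q\<rfloor> + 1 \<le> z" by linarith
    then have "real_of_int (\<lfloor>- q\<rfloor> + 1) \<le> of_int z" by (rule of_int_le_iff[THEN iffD2])
    then show ?thesis using z by (simp add: n0_def)
  qed
  have ne: "cmod (e (of_real n * \<tau>)) = exp (- 2 * pi * n * Im \<tau>)" for n \<tau>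
    by (simp add: e_def norm_exp_eq_Re algebra_simps)
  have "(\<lambda>n. a n * e (of_real n * \<i>)) summable_on ?S"
    using a[of \<i>] by (auto simp: upper_half_def summable_on_def)
  then have summ: "(\<lambda>n. cmod (a n) * exp (- 2 * pi * n)) summable_on ?S"
    by (subst (asm) summable_on_iff_abs_summable_on_complex) (simp add: norm_mult ne)
  define C where "C = (\<Sum>\<^sub>\<infinity>n\<in>?S. cmod (a n) * exp (- 2 * pi * n))"
  have "cmod (f \<tau> \<xi>) \<le> C * exp (- (2 * pi * n0) * (Im \<tau> - 1))" if \<tau>: "Im \<tau> \<ge> 1" for \<tau>
  proof -
    have \<tau>H: "\<tau> \<in> upper_half" using \<tau> by (simp add: upper_half_def)
    let ?E = "exp (- (2 * pi * n0) * (Im \<tau> - 1))"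
    have le: "norm (a n * e (of_real n * \<tau>)) \<le> cmod (a n) * exp (- 2 * pi * n) * ?E" if "n \<in> ?S" for n
    proof -
      have "n0 * (Im \<tau> - 1) \<le> n * (Im \<tau> - 1)" using S[OF that] \<tau> by (intro mult_right_mono) auto
      then have "2 * pi * (n0 * (Im \<tau> - 1)) \<le> 2 * pi * (n * (Im \<tau> - 1))" by (intro mult_left_mono) auto
      then have "- 2 * pi * n * Im \<tau> \<le> - 2 * pi * n + (- (2 * pi * n0) * (Im \<tau> - 1))"
        by (simp add: algebra_simps)
      then have "exp (- 2 * pi * n * Im \<tau>) \<le> exp (- 2 * pi * n) * ?E" by (simp only: exp_add[symmetric] exp_le_cancel_iff)
      then have "cmod (a n) * exp (- 2 * pi * n * Im \<tau>) \<le> cmod (a n) * (exp (- 2 * pi * n) * ?E)"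
        by (rule mult_left_mono) simp
      then show ?thesis by (simp only: norm_mult ne mult.assoc)
    qed
    have hs: "((\<lambda>n. cmod (a n) * exp (- 2 * pi * n) * ?E) has_sum (C * ?E)) ?S"
      unfolding C_def using has_sum_infsum[OF summ] by (rule has_sum_cmult_left)
    show ?thesis by (rule norm_infsum_le[OF a[OF \<tau>H] hs le])
  qed
  then show ?thesis using n0 by (intro exI[of _ C] exI[of _ "2 * pi * n0"]) auto
qed

text \<open>The bound of \<open>component_decay\<close> depends on the imaginary part only, and the
  exponential beats the power for any \<open>k\<close>, so one height serves all real parts.\<close>

lemma pet_decay:
  assumes "\<epsilon> > 0"
  obtains Y where "\<And>\<tau>. Im \<tau> > Y \<Longrightarrow> pet \<tau> < \<epsilon>"
proof -
  obtain C c where c: "\<And>\<xi>. \<xi> \<in> carrier D \<Longrightarrow> 0 < c \<xi> \<and> (\<forall>\<tau>. Im \<tau> \<ge> 1 \<longrightarrow> cmod (f \<tau> \<xi>) \<le> C \<xi> * exp (- c \<xi> * (Im \<tau> - 1)))"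
    using component_decay by metis
  define b where "b = (\<lambda>y. \<Sum>\<xi>\<in>carrier D. C \<xi> * (y powr (k / 2) * exp (- c \<xi> * (y - 1))))"
  have "(b \<longlongrightarrow> (\<Sum>\<xi>\<in>carrier D. C \<xi> * 0)) at_top"
    unfolding b_def
  proof (intro tendsto_sum tendsto_mult tendsto_const)
    fix \<xi> assume "\<xi> \<in> carrier D"
    then have "c \<xi> > 0" using c by auto
    then show "((\<lambda>y. y powr (k / 2) * exp (- c \<xi> * (y - 1))) \<longlongrightarrow> 0) at_top"
      by real_asymp
  qed
  then have "eventually (\<lambda>y. b y < \<epsilon>) at_top" using assms by (intro order_tendstoD) auto
  then obtain Y where Y: "\<And>y. y \<ge> Y \<Longrightarrow> b y < \<epsilon>" by (auto simp: eventually_at_top_linorder)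
  have "pet \<tau> < \<epsilon>" if \<tau>: "Im \<tau> > max 1 Y" for \<tau>
  proof -
    have "pet \<tau> \<le> Im \<tau> powr (k / 2) * (\<Sum>\<xi>\<in>carrier D. cmod (f \<tau> \<xi>))"
      unfolding pet_def by (intro mult_left_mono nrm_le_sum) simp
    also have "\<dots> \<le> Im \<tau> powr (k / 2) * (\<Sum>\<xi>\<in>carrier D. C \<xi> * exp (- c \<xi> * (Im \<tau> - 1)))"
      using c \<tau> by (intro mult_left_mono sum_mono) auto
    also have "\<dots> = b (Im \<tau>)" by (simp add: b_def sum_distrib_left mult_ac)
    also have "\<dots> < \<epsilon>" using Y \<tau> by simp
    finally show ?thesis .
  qed
  then show thesis using that by blast
qed

lemma pet_reduce_step:
  assumes "\<tau> \<in> upper_half"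
  obtains \<tau>' where "\<tau>' \<in> upper_half" "Im \<tau>' = Im \<tau>" "\<bar>Re \<tau>'\<bar> \<le> 1 / 2" "pet \<tau>' = pet \<tau>"
proof -
  define n where "n = - round (Re \<tau>)"
  obtain t where t: "t \<in> Mp2Z" "fst t = mat2 1 (of_int n) 0 1"
    using subgroup_T_powers[OF subgroup_Mp2Z T_bar_Mp2Z] by blast
  have "moebius (fst t) \<tau> = \<tau> + of_int n" by (simp add: t(2) moebius_def)
  then have "pet (\<tau> + of_int n) = pet \<tau>" using pet_invariant[OF t(1) assms] by simp
  moreover have "\<bar>Re (\<tau> + of_int n)\<bar> \<le> 1 / 2"
    using of_int_round_abs_le[of "Re \<tau>"] by (simp add: n_def abs_minus_commute)
  ultimately show thesis using assms by (intro that[of "\<tau> + of_int n"]) (auto simp: upper_half_def)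
qed

text \<open>If \<open>\<bar>Re \<tau>\<bar> \<le> 1/2\<close> and \<open>Im \<tau> < 1/2\<close>, then \<open>\<bar>\<tau>\<bar>\<^sup>2 < 1/2\<close>, so \<open>S_bar\<close> at least doubles
  the imaginary part; hence finitely many steps suffice.\<close>

lemma pet_reduce:
  assumes "\<tau> \<in> upper_half"
  obtains \<tau>' where "Im \<tau>' \<ge> 1 / 2" "\<bar>Re \<tau>'\<bar> \<le> 1 / 2" "pet \<tau>' = pet \<tau>"
proof -
  \<comment> \<open>Here \<open>n\<close> bounds the number of doublings needed for the imaginary
    part to reach 1/2.\<close>
  have main: "\<tau> \<in> upper_half \<Longrightarrow> Im \<tau> * 2 ^ n \<ge> 1 / 2 \<Longrightarrow>
      \<exists>\<tau>'. Im \<tau>' \<ge> 1 / 2 \<and> \<bar>Re \<tau>'\<bar> \<le> 1 / 2 \<and> pet \<tau>' = pet \<tau>" for n \<tau>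
  proof (induction n arbitrary: \<tau>)
    case 0
    then show ?case using pet_reduce_step[OF 0(1)] by (metis mult.right_neutral power_0)
  next
    case (Suc n)
    obtain \<sigma> where \<sigma>: "\<sigma> \<in> upper_half" "Im \<sigma> = Im \<tau>" "\<bar>Re \<sigma>\<bar> \<le> 1 / 2" "pet \<sigma> = pet \<tau>"
      using pet_reduce_step[OF Suc.prems(1)] by blast
    show ?case
    proof (cases "Im \<sigma> \<ge> 1 / 2")
      case True
      then show ?thesis using \<sigma> by blast
    next
      case False
      let ?\<rho> = "moebius (fst S_bar) \<sigma>"
      have pos: "Im \<sigma> > 0" using \<sigma>(1) by (simp add: upper_half_def)
      have "(cmod \<sigma>)\<^sup>2 = (Re \<sigma>)\<^sup>2 + (Im \<sigma>)\<^sup>2" by (rule cmod_power2)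
      also have "\<dots> \<le> (1 / 2)\<^sup>2 + (1 / 2)\<^sup>2"
        using \<sigma>(3) False pos by (intro add_mono power2_le_iff_abs_le[THEN iffD2]) auto
      finally have le: "(cmod \<sigma>)\<^sup>2 \<le> 1 / 2" by (simp add: power2_eq_square)
      have nz: "(cmod \<sigma>)\<^sup>2 > 0" using pos by auto
      have "Im ?\<rho> = Im \<sigma> / (cmod \<sigma>)\<^sup>2"
        unfolding Im_moebius by (simp add: S_bar_mat2 det_mat2 auto_factor_def)
      also have "\<dots> \<ge> Im \<sigma> / (1 / 2)" using le nz pos by (intro divide_left_mono) auto
      finally have "Im ?\<rho> \<ge> 2 * Im \<tau>" using \<sigma>(2) by simp
      then have "Im ?\<rho> * 2 ^ n \<ge> 2 * Im \<tau> * 2 ^ n" by (intro mult_right_mono) auto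
      then have "Im ?\<rho> * 2 ^ n \<ge> 1 / 2" using Suc.prems(2) unfolding power_Suc by linarith
      moreover have "?\<rho> \<in> upper_half"
        using \<sigma>(1) by (intro moebius_upper_half) (simp_all add: S_bar_mat2 det_mat2)
      moreover have "pet ?\<rho> = pet \<tau>" using pet_invariant[OF S_bar_Mp2Z \<sigma>(1)] \<sigma>(4) by simp
      ultimately show ?thesis using Suc.IH[of ?\<rho>] by simp
    qed
  qed
  have pos: "Im \<tau> > 0" using assms by (simp add: upper_half_def)
  obtain n where "1 / (2 * Im \<tau>) < 2 ^ n" using real_arch_pow[of 2 "1 / (2 * Im \<tau>)"] by auto
  then have "Im \<tau> * 2 ^ n \<ge> 1 / 2" using pos by (simp add: field_simps)
  from main[OF assms this] show thesis using that by blast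
qed

lemma pet_continuous: "continuous_on upper_half pet"
proof -
  have "continuous_on upper_half (\<lambda>\<tau>. f \<tau> \<xi>)" if "\<xi> \<in> carrier D" for \<xi>
    using cusp that by (auto simp: cusp_forms_def intro: holomorphic_on_imp_continuous_on)
  then show ?thesis
    unfolding pet_def nrm_def L2_set_def
    by (intro continuous_intros) (auto simp: upper_half_def)
qed

text \<open>By \<open>pet_reduce\<close>, all values of \<open>pet\<close> occur in a half-strip.
  Above some height they stay below \<open>pet \<tau>1\<close>, so the supremum is that of a
  continuous function on a compact rectangle.\<close>

lemma pet_attains_max:
  assumes "\<tau>1 \<in> upper_half" "pet \<tau>1 > 0"
  obtains \<tau>0 where "\<tau>0 \<in> upper_half" "pet \<tau>0 > 0" "\<And>\<tau>. \<tau> \<in> upper_half \<Longrightarrow> pet \<tau> \<le> pet \<tau>0"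
proof -
  \<comment> \<open>Comparing with \<open>pet \<tau>1\<close> ensures that the reduced image of
    \<open>\<tau>1\<close> lies below this height, so the rectangle is nonempty.\<close>
  obtain Y where Y: "\<And>\<tau>. Im \<tau> > Y \<Longrightarrow> pet \<tau> < pet \<tau>1" using pet_decay[OF assms(2)] by blast
  define K where "K = cbox (Complex (- 1 / 2) (1 / 2)) (Complex (1 / 2) Y)"
  have mem: "\<tau> \<in> K \<longleftrightarrow> \<bar>Re \<tau>\<bar> \<le> 1 / 2 \<and> 1 / 2 \<le> Im \<tau> \<and> Im \<tau> \<le> Y" for \<tau>
    by (auto simp: K_def in_cbox_complex_iff)
  have KH: "K \<subseteq> upper_half" by (auto simp: mem upper_half_def)
  obtain \<tau>2 where \<tau>2: "Im \<tau>2 \<ge> 1 / 2" "\<bar>Re \<tau>2\<bar> \<le> 1 / 2" "pet \<tau>2 = pet \<tau>1"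
    using pet_reduce[OF assms(1)] by blast
  then have \<tau>2K: "\<tau>2 \<in> K" using Y[of \<tau>2] by (force simp: mem)
  obtain \<tau>0 where \<tau>0: "\<tau>0 \<in> K" "\<And>\<tau>. \<tau> \<in> K \<Longrightarrow> pet \<tau> \<le> pet \<tau>0"
    using continuous_attains_sup[of K pet] continuous_on_subset[OF pet_continuous KH] \<tau>2K
    by (auto simp: K_def)
  have "pet \<tau> \<le> pet \<tau>0" if \<tau>: "\<tau> \<in> upper_half" for \<tau>
  proof -
    obtain \<sigma> where \<sigma>: "Im \<sigma> \<ge> 1 / 2" "\<bar>Re \<sigma>\<bar> \<le> 1 / 2" "pet \<sigma> = pet \<tau>" using pet_reduce[OF \<tau>] by blast
    show ?thesis
    proof (cases "Im \<sigma> \<le> Y")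
      case True
      then show ?thesis using \<tau>0(2)[of \<sigma>] \<sigma> by (simp add: mem)
    next
      case False
      then show ?thesis using Y[of \<sigma>] \<sigma> \<tau>2 \<tau>0(2)[OF \<tau>2K] by simp
    qed
  qed
  then show thesis using that[of \<tau>0] \<tau>0 KH \<tau>2 \<tau>0(2)[OF \<tau>2K] assms(2) by force
qed

text \<open>The given maximum may itself be carried to another maximum, so the point obtained can
  differ from \<open>\<tau>0\<close>: some point of the orbit of \<open>\<tau>0\<close> has to
  qualify. As \<open>m > 1\<close>, the imaginary parts along the orbit grow without bound.\<close>

lemma pet_max_not_fixed:
  assumes "m > 1" "\<tau>0 \<in> upper_half" "pet \<tau>0 > 0" "\<And>\<tau>. \<tau> \<in> upper_half \<Longrightarrow> pet \<tau> \<le> pet \<tau>0"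
  shows "\<exists>\<tau>\<in>upper_half. pet \<tau> = pet \<tau>0 \<and> pet (moebius (fst (g_sq m)) \<tau>) < pet \<tau>0"
proof (rule ccontr)
  assume "\<not> ?thesis"
  then have step: "\<not> pet (moebius (fst (g_sq m)) \<tau>) < pet \<tau>0" if "\<tau> \<in> upper_half" "pet \<tau> = pet \<tau>0" for \<tau>
    using that by blast
  have g: "moebius (fst (g_sq m)) \<tau> = of_real ((real m)\<^sup>2) * \<tau>" for \<tau>
    by (simp add: g_sq_mat2 moebius_def)
  define \<sigma> where "\<sigma> = (\<lambda>n. of_real (((real m)\<^sup>2) ^ n) * \<tau>0)"
  have "\<sigma> n \<in> upper_half \<and> pet (\<sigma> n) = pet \<tau>0" for n
  proof (induction n)
    case 0
    then show ?case using assms(2) by (simp add: \<sigma>_def)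
  next
    case (Suc n)
    have "\<sigma> (Suc n) = moebius (fst (g_sq m)) (\<sigma> n)" unfolding g by (simp add: \<sigma>_def mult_ac)
    moreover have "\<sigma> (Suc n) \<in> upper_half" using assms(1,2) by (simp add: \<sigma>_def upper_half_def)
    ultimately show ?case using step[of "\<sigma> n"] Suc assms(4)[of "\<sigma> (Suc n)"] by simp
  qed
  moreover obtain Y where Y: "\<And>\<tau>. Im \<tau> > Y \<Longrightarrow> pet \<tau> < pet \<tau>0" using pet_decay[OF assms(3)] by blast
  moreover have pos: "Im \<tau>0 > 0" using assms(2) by (simp add: upper_half_def)
  moreover obtain n where "Y / Im \<tau>0 < ((real m)\<^sup>2) ^ n"
    using real_arch_pow[of "(real m)\<^sup>2" "Y / Im \<tau>0"] assms(1) by (auto simp: one_less_power)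
  moreover from this have "Im (\<sigma> n) > Y" using pos by (simp add: \<sigma>_def field_simps)
  ultimately show False by (metis less_irrefl)
qed

section \<open>The strict eigenvalue bound\<close>

text \<open>At a maximum every coset contributes at most the maximum, and at a maximum supplied by
  \<open>pet_max_not_fixed\<close> the coset of \<open>g_sq m\<close> contributes strictly less.
  Dividing by the positive maximal value leaves the bound.\<close>

theorem hecke_eigenvalue_bound:
  assumes "m > 1" "hecke_eigenform L \<beta> k m f \<Lambda>"
  shows "cmod \<Lambda> < real m powr (k - 2) * real (card (hecke_cosets m)) * sqrt (card (torsion L \<beta> m))"
proof -
  let ?t = "sqrt (card (torsion L \<beta> m))" and ?H = "hecke_cosets m"
  have m0: "m > 0" using assms(1) by simp
  obtain \<tau>1 where \<tau>1: "\<tau>1 \<in> upper_half" "f \<tau>1 \<noteq> (\<lambda>_. 0)"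
    using assms(2) by (auto simp: hecke_eigenform_def)
  have "nrm (f \<tau>1) > 0"
    using nrm_eq_0[OF f_group_algebra[OF \<tau>1(1)]] \<tau>1(2) nrm_nonneg[of "f \<tau>1"] by fastforce
  then have "pet \<tau>1 > 0" using \<tau>1(1) by (simp add: pet_def upper_half_def)
  then obtain \<tau>0 where \<tau>0: "\<tau>0 \<in> upper_half" "pet \<tau>0 > 0" "\<And>\<tau>. \<tau> \<in> upper_half \<Longrightarrow> pet \<tau> \<le> pet \<tau>0"
    using pet_attains_max[OF \<tau>1(1)] by blast
  obtain \<tau> where \<tau>: "\<tau> \<in> upper_half" "pet \<tau> = pet \<tau>0" "pet (moebius (fst (g_sq m)) \<tau>) < pet \<tau>0"
    using pet_max_not_fixed[OF assms(1) \<tau>0] by blast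
  let ?p = "\<lambda>C :: mp set. pet (moebius (fst (SOME \<delta>. \<delta> \<in> C)) \<tau>)"
  have le: "?p C \<le> pet \<tau>0" if "C \<in> ?H" for C
  proof -
    have "(SOME \<delta>. \<delta> \<in> C) \<in> carrier GL2_cover"
      using hecke_coset_rep[OF m0 that] double_coset_carrier[OF m0] by blast
    then show ?thesis
      using \<tau>0(3) moebius_upper_half \<tau>(1) by (cases "SOME \<delta>. \<delta> \<in> C") (auto simp: carrier_GL2_iff)
  qed
  let ?C0 = "Mp2Z #>\<^bsub>GL2_cover\<^esub> g_sq m"
  have C0: "?C0 \<in> ?H" unfolding hecke_cosets_def using g_sq_double_coset[OF m0] by blast
  \<comment> \<open>The representative chosen by \<open>SOME\<close> has the form
    \<open>\<kappa> \<otimes> g_sq m\<close> with \<open>\<kappa>\<close> in \<open>Mp2Z\<close>,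
    and invariance of \<open>pet\<close> removes \<open>\<kappa>\<close>.\<close>
  have lt: "?p ?C0 < pet \<tau>0"
  proof -
    obtain \<kappa> where \<kappa>: "\<kappa> \<in> Mp2Z" "(SOME \<delta>. \<delta> \<in> ?C0) = \<kappa> \<otimes>\<^bsub>GL2_cover\<^esub> g_sq m"
      using hecke_coset_rep(1)[OF m0 C0] unfolding r_coset_def by blast
    have d: "det (fst \<kappa>) > 0" "det (fst (g_sq m)) > 0"
      using \<kappa>(1) m0 by (cases \<kappa>; simp add: Mp2Z_iff g_sq_mat2 det_mat2)+
    have "moebius (fst (\<kappa> \<otimes>\<^bsub>GL2_cover\<^esub> g_sq m)) \<tau> = moebius (fst \<kappa>) (moebius (fst (g_sq m)) \<tau>)"
      using moebius_mult[OF d \<tau>(1)] by simp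
    then show ?thesis
      using pet_invariant[OF \<kappa>(1) moebius_upper_half[OF d(2) \<tau>(1)]] \<tau>(3) \<kappa>(2) by simp
  qed
  have "(\<Sum>C\<in>?H. ?p C) < (\<Sum>C\<in>?H. pet \<tau>0)"
    by (rule sum_strict_mono_ex1) (use finite_hecke_cosets[OF m0] le lt C0 in blast)+
  then have sum: "(\<Sum>C\<in>?H. ?p C) < real (card ?H) * pet \<tau>0" by simp
  have "hecke L \<beta> k m f \<tau> = (\<lambda>\<mu>. \<Lambda> * f \<tau> \<mu>)"
    using assms(2) \<tau>(1) by (simp add: hecke_eigenform_def)
  then have "cmod \<Lambda> * pet \<tau>0 = nrm (hecke L \<beta> k m f \<tau>) * Im \<tau> powr (k / 2)"
    unfolding \<tau>(2)[symmetric] by (simp add: pet_def nrm_scale)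
  also have "\<dots> \<le> real m powr (k - 2) * (?t * (\<Sum>C\<in>?H. ?p C))"
    by (rule hecke_bound[OF m0 \<tau>(1)])
  also have "\<dots> < real m powr (k - 2) * (?t * (real (card ?H) * pet \<tau>0))"
    using sum m0 card_torsion_ge_1[of m] by (intro mult_strict_left_mono) auto
  finally show ?thesis using \<tau>0(2) by (simp add: mult_ac)
qed

end

theorem lemma4p11:
  fixes L :: "'a::real_vector set" and \<beta> :: "'a \<Rightarrow> 'a \<Rightarrow> real"
    and k :: real and m :: nat and f :: "complex \<Rightarrow> 'a set \<Rightarrow> complex" and \<Lambda> :: complex
  assumes "even_lattice L \<beta>" and "2 * k \<in> \<int>" and "m > 1"
    and "hecke_eigenform L \<beta> k m f \<Lambda>"
  shows "cmod \<Lambda> < real m powr (k - 2) * real (card (hecke_cosets m)) * real (card (torsion L \<beta> m)) \<and>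
         (prime m \<longrightarrow>
           cmod \<Lambda> < real m powr (k - 1) * (real m + 1) * real (card (torsion L \<beta> m)))"
proof -
  interpret cusp_form L \<beta> k f
    by unfold_locales (use assms in \<open>auto simp: hecke_eigenform_def\<close>)
  let ?t = "real (card (torsion L \<beta> m))"
  \<comment> \<open>The torsion contains the neutral element, so its order is at least 1 and
    dominates its own square root.\<close>
  have t1: "?t \<ge> 1" using card_torsion_ge_1[of m] by simp
  then have "?t \<le> ?t\<^sup>2" by (simp add: power2_eq_square)
  then have "sqrt ?t \<le> ?t" by (intro real_le_lsqrt) auto
  then have "real m powr (k - 2) * real (card (hecke_cosets m)) * sqrt ?t
      \<le> real m powr (k - 2) * real (card (hecke_cosets m)) * ?t"
    by (intro mult_left_mono) auto
  with hecke_eigenvalue_bound[OF assms(3,4)]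
  have bound: "cmod \<Lambda> < real m powr (k - 2) * real (card (hecke_cosets m)) * ?t" by simp
  moreover have "cmod \<Lambda> < real m powr (k - 1) * (real m + 1) * ?t" if "prime m"
  proof -
    \<comment> \<open>One factor \<open>m\<close> of the coset bound raises the exponent from
      \<open>k - 2\<close> to \<open>k - 1\<close>.\<close>
    have "real (card (hecke_cosets m)) \<le> real (m * (m + 1))"
      using card_hecke_cosets_prime[OF that] by (rule of_nat_mono)
    then have "real m powr (k - 2) * real (card (hecke_cosets m)) * ?t
        \<le> real m powr (k - 2) * (real m * (real m + 1)) * ?t"
      by (intro mult_right_mono mult_left_mono) (auto simp: algebra_simps)
    also have "real m powr (k - 2) * (real m * (real m + 1)) = real m powr (k - 1) * (real m + 1)"
      using assms(3) powr_add[of "real m" "k - 2" 1] by simp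
    finally show ?thesis using bound by simp
  qed
  ultimately show ?thesis by blast
qed

end
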